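(* Suppose that $M\subset\mathbb{C}^m$ and $N\subset\mathbb{C}^n$ are bounded, connected, embedded complex submanifolds and that $(M,\mathsf{k}_M)$ is a complete Gromov hyperbolic space. Let $f:M\to N$ be an isometric embedding with respect to the Kobayashi distances, i.e. $\mathsf{k}_N(f(x),f(y))=\mathsf{k}_M(x,y)$ for all $x,y\in M$, and suppose that $S:=f(M)$ (which is a geodesic subspace of $N$) is a visibility subspace of $N$. Then $f$ extends to a continuous map $\widehat f:\overline{M}^G\to\overline N$, where $\overline{M}^G$ denotes the Gromov compactification of $(M,\mathsf{k}_M)$. Further, if $S$ has no geodesic loops in $\overline S$, then $\widehat f$ is a homeomorphism from $\overline{M}^G$ to $\overline S$.
   Context: $\mathsf{k}_M,\mathsf{k}_N$ are the Kobayashi distances. $\overline N$ and $\overline S$ denote closures in $\mathbb{C}^n$, and $\partial_a S:=\overline S\setminus S$. A $\mathsf{k}_N$-geodesic is a map $\sigma:I\to N$, $I\subset\mathbb{R}$ an interval, with $\mathsf{k}_N(\sigma(s),\sigma(t))=|s-t|$ for all $s,t\in I$. A subset $S$ of $N$ is a geodesic subspace if (i) $(S,\mathsf{k}_N|_{S\times S})$ is Cauchy-complete, and (ii) for any two distinct points of $S$ there exists a geodesic of $(N,\mathsf{k}_N)$ that passes through those points and is contained in $S$. A geodesic subspace $S$ is a visibility subspace of $N$ if for any $p\neq q$ in $\partial_a S$ there exist $\mathbb{C}^n$-neighbourhoods $U$ of $p$ and $V$ of $q$ with $\overline U\cap\overline V=\emptyset$ and a compact subset $K$ of $S$ such that,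 for every $\mathsf{k}_N$-geodesic $\gamma$ in $S$ with initial point in $U\cap S$ and terminal point in $V\cap S$, the image of $\gamma$ meets $K$. A geodesic loop of $S$ in $\overline S$ is a geodesic line $\gamma$ in $(S,\mathsf{k}_N|_{S\times S})$ (an isometric embedding of $(\mathbb{R},|\cdot|)$) such that the set of limit points in $\overline S$ of $\gamma(t)$ as $t\to\infty$ equals the set of limit points in $\overline S$ of $\gamma(t)$ as $t\to-\infty$. For a proper geodesic Gromov hyperbolic distance space $(X,d)$, the Gromov compactification is $\overline X^G=X\sqcup\partial_GX$, where $\partial_G X$ is the set of geodesic rays modulo the relation of being at bounded distance from each other, with the standard topology, described as follows: fixing a basepoint $o$ and calling "generalized ray" a geodesic ray from $o$, or a geodesic segment from $o$ continued as a constant at its endpoint (with $c(\infty)$ denoting the class of $c$ in $\partial_GX$ in the first case and the endpoint of the segment in the second), $x_n\to x$ in $\overline X^G$ iff there exist generalized rays $c_n$ from $o$ with $c_n(\infty)=x_n$ such that every subsequence of $(c_n)$ has a further subsequence converging uniformly on compact sets to a generalized ray $c$ with $c(\infty)=x$. It is a compact Hausdorff space containing $X$ as an open dense subset. (When $(M,\mathsf{k}_M)$ is complete it is proper and geodesic, by the Hopf--Rinow theorem.) *)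

theory Defs
  imports "HOL-Complex_Analysis.Complex_Analysis"
begin

section \<open>Complex submanifolds and the Kobayashi distance\<close>

definition holomorphic_map_on ::
  "(complex ^ 'm \<Rightarrow> complex ^ 'n) \<Rightarrow> (complex ^ 'm) set \<Rightarrow> bool" where
  "holomorphic_map_on \<phi> U \<longleftrightarrow>
     (\<forall>z\<in>U. \<exists>A. (\<phi> has_derivative A) (at z) \<and> (\<forall>c v. A (c *s v) = c *s A v))"

text \<open>The model is the coordinate subspace spanned by the coordinates in \<open>I\<close>; as \<open>I\<close> does not
  depend on the point, \<open>M\<close> has pure complex dimension \<open>card I\<close>. \<open>M\<close> need not be closed.\<close>

definition embedded_complex_submanifold :: "(complex ^ 'm) set \<Rightarrow> bool" where
  "embedded_complex_submanifold M \<longleftrightarrow>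
     (\<exists>I :: 'm set. \<forall>p\<in>M. \<exists>U. \<exists>\<phi> \<psi> :: complex ^ 'm \<Rightarrow> complex ^ 'm. open U \<and> p \<in> U \<and> open (\<phi> ` U) \<and>
        holomorphic_map_on \<phi> U \<and> holomorphic_map_on \<psi> (\<phi> ` U) \<and> (\<forall>z\<in>U. \<psi> (\<phi> z) = z) \<and>
        \<phi> ` (U \<inter> M) = \<phi> ` U \<inter> {w. \<forall>i. i \<notin> I \<longrightarrow> w $ i = 0})"

text \<open>For an embedded submanifold, a map from the disc into \<open>M\<close> is holomorphic iff it is
  holomorphic as a map into the ambient space.\<close>

definition holomorphic_disc :: "(complex ^ 'm) set \<Rightarrow> (complex \<Rightarrow> complex ^ 'm) \<Rightarrow> bool" where
  "holomorphic_disc M \<phi> \<longleftrightarrow>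
     (\<forall>i. (\<lambda>z. \<phi> z $ i) holomorphic_on ball 0 1) \<and> \<phi> ` ball 0 1 \<subseteq> M"

text \<open>Normalisation: curvature \<open>-4\<close>.\<close>

definition poincare_dist :: "complex \<Rightarrow> complex \<Rightarrow> real" where
  "poincare_dist z w = artanh (norm ((z - w) / (1 - cnj w * z)))"

definition kobayashi_chain_length ::
  "(complex ^ 'm) set \<Rightarrow> complex ^ 'm \<Rightarrow> complex ^ 'm \<Rightarrow> real \<Rightarrow> bool" where
  "kobayashi_chain_length M p q L \<longleftrightarrow>
     (\<exists>k x \<phi> a b. x 0 = p \<and> x k = q \<and>
        (\<forall>j<k. holomorphic_disc M (\<phi> j) \<and> a j \<in> ball 0 1 \<and> b j \<in> ball 0 1 \<and>
               \<phi> j (a j) = x j \<and> \<phi> j (b j) = x (Suc j)) \<and>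
        L = (\<Sum>j<k. poincare_dist (a j) (b j)))"

text \<open>The value \<open>0\<close> off \<open>M\<close> is only there because \<^locale>\<open>Metric_space\<close> wants a
  nonnegative symmetric function on the whole type. The infimum is over a nonempty set whenever
  \<open>M\<close> is connected.\<close>

definition kobayashi_dist :: "(complex ^ 'm) set \<Rightarrow> complex ^ 'm \<Rightarrow> complex ^ 'm \<Rightarrow> real" where
  "kobayashi_dist M p q =
     (if p \<in> M \<and> q \<in> M then Inf {L. kobayashi_chain_length M p q L} else 0)"


section \<open>Geodesics and Gromov hyperbolicity\<close>

text \<open>Throughout, a distance space is a carrier \<open>X\<close> with a distance \<open>d\<close> as in
  \<^locale>\<open>Metric_space\<close>, so that restricting the distance to a subset only changes the carrier.\<close>

definition complete_distance_space :: "'a set \<Rightarrow> ('a \<Rightarrow> 'a \<Rightarrow> real) \<Rightarrow> bool" where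
  "complete_distance_space X d \<longleftrightarrow> Metric_space X d \<and> Metric_space.mcomplete X d"

definition geodesic_on ::
  "'a set \<Rightarrow> ('a \<Rightarrow> 'a \<Rightarrow> real) \<Rightarrow> real set \<Rightarrow> (real \<Rightarrow> 'a) \<Rightarrow> bool" where
  "geodesic_on X d I \<sigma> \<longleftrightarrow>
     is_interval I \<and> \<sigma> ` I \<subseteq> X \<and> (\<forall>s\<in>I. \<forall>t\<in>I. d (\<sigma> s) (\<sigma> t) = \<bar>s - t\<bar>)"

definition gromov_product :: "('a \<Rightarrow> 'a \<Rightarrow> real) \<Rightarrow> 'a \<Rightarrow> 'a \<Rightarrow> 'a \<Rightarrow> real" where
  "gromov_product d p x y = (d x p + d y p - d x y) / 2"

definition gromov_hyperbolic :: "'a set \<Rightarrow> ('a \<Rightarrow> 'a \<Rightarrow> real) \<Rightarrow> bool" where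
  "gromov_hyperbolic X d \<longleftrightarrow>
     (\<exists>\<delta>\<ge>0. \<forall>p\<in>X. \<forall>x\<in>X. \<forall>y\<in>X. \<forall>z\<in>X.
        gromov_product d p x z \<ge> min (gromov_product d p x y) (gromov_product d p y z) - \<delta>)"


section \<open>The Gromov compactification\<close>

text \<open>Rays are total functions whose values at negative times are irrelevant; the equivalence
  below only looks at nonnegative times.\<close>

definition geodesic_rays :: "'a set \<Rightarrow> ('a \<Rightarrow> 'a \<Rightarrow> real) \<Rightarrow> (real \<Rightarrow> 'a) set" where
  "geodesic_rays X d = {c. geodesic_on X d {0..} c}"

definition asymptotic_rays ::
  "'a set \<Rightarrow> ('a \<Rightarrow> 'a \<Rightarrow> real) \<Rightarrow> ((real \<Rightarrow> 'a) \<times> (real \<Rightarrow> 'a)) set" where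
  "asymptotic_rays X d =
     {(c, c'). c \<in> geodesic_rays X d \<and> c' \<in> geodesic_rays X d \<and>
               (\<exists>B. \<forall>t\<ge>0. d (c t) (c' t) \<le> B)}"

definition gromov_boundary :: "'a set \<Rightarrow> ('a \<Rightarrow> 'a \<Rightarrow> real) \<Rightarrow> (real \<Rightarrow> 'a) set set" where
  "gromov_boundary X d = geodesic_rays X d // asymptotic_rays X d"

definition gromov_closure ::
  "'a set \<Rightarrow> ('a \<Rightarrow> 'a \<Rightarrow> real) \<Rightarrow> ('a + (real \<Rightarrow> 'a) set) set" where
  "gromov_closure X d = X <+> gromov_boundary X d"

text \<open>\<open>generalized_ray_to X d p c x\<close>: \<open>c\<close> is a generalized ray from \<open>p\<close> with
  \<open>c(\<infinity>) = x\<close>.\<close>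

definition generalized_ray_to ::
  "'a set \<Rightarrow> ('a \<Rightarrow> 'a \<Rightarrow> real) \<Rightarrow> 'a \<Rightarrow> (real \<Rightarrow> 'a) \<Rightarrow> 'a + (real \<Rightarrow> 'a) set \<Rightarrow> bool" where
  "generalized_ray_to X d p c x \<longleftrightarrow> c 0 = p \<and>
     (c \<in> geodesic_rays X d \<and> x = Inr (asymptotic_rays X d `` {c}) \<or>
      (\<exists>R\<ge>0. geodesic_on X d {0..R} c \<and> (\<forall>t\<ge>R. c t = c R) \<and> x = Inl (c R)))"

definition converges_on_compacts ::
  "('a \<Rightarrow> 'a \<Rightarrow> real) \<Rightarrow> (nat \<Rightarrow> real \<Rightarrow> 'a) \<Rightarrow> (real \<Rightarrow> 'a) \<Rightarrow> bool" where
  "converges_on_compacts d c c' \<longleftrightarrow>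
     (\<forall>K\<subseteq>{0..}. compact K \<longrightarrow>
        (\<forall>\<epsilon>>0. eventually (\<lambda>n. \<forall>t\<in>K. d (c n t) (c' t) < \<epsilon>) sequentially))"

definition gromov_converges ::
  "'a set \<Rightarrow> ('a \<Rightarrow> 'a \<Rightarrow> real) \<Rightarrow> 'a \<Rightarrow> (nat \<Rightarrow> 'a + (real \<Rightarrow> 'a) set) \<Rightarrow>
     'a + (real \<Rightarrow> 'a) set \<Rightarrow> bool" where
  "gromov_converges X d p xs x \<longleftrightarrow>
     (\<exists>c. (\<forall>n. generalized_ray_to X d p (c n) (xs n)) \<and>
        (\<forall>r::nat \<Rightarrow> nat. strict_mono r \<longrightarrow>
           (\<exists>s::nat \<Rightarrow> nat. \<exists>c'. strict_mono s \<and>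
              converges_on_compacts d (c \<circ> r \<circ> s) c' \<and> generalized_ray_to X d p c' x)))"

text \<open>The topology with this convergence of sequences: a set is closed iff it contains the limits
  of its convergent sequences.\<close>

definition gromov_open ::
  "'a set \<Rightarrow> ('a \<Rightarrow> 'a \<Rightarrow> real) \<Rightarrow> 'a \<Rightarrow> ('a + (real \<Rightarrow> 'a) set) set \<Rightarrow> bool" where
  "gromov_open X d p W \<longleftrightarrow> W \<subseteq> gromov_closure X d \<and>
     (\<forall>xs x. (\<forall>n. xs n \<in> gromov_closure X d - W) \<and> x \<in> gromov_closure X d \<and>
             gromov_converges X d p xs x \<longrightarrow> x \<in> gromov_closure X d - W)"

definition gromov_compactification ::
  "'a set \<Rightarrow> ('a \<Rightarrow> 'a \<Rightarrow> real) \<Rightarrow> 'a \<Rightarrow> ('a + (real \<Rightarrow> 'a) set) topology" where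
  "gromov_compactification X d p = topology (gromov_open X d p)"

lemma gromov_converges_subseq:
  assumes "gromov_converges X d p xs x" "strict_mono (r :: nat \<Rightarrow> nat)"
  shows "gromov_converges X d p (xs \<circ> r) x"
proof -
  obtain c where c: "\<forall>n. generalized_ray_to X d p (c n) (xs n)"
    and sub: "\<And>r::nat \<Rightarrow> nat. strict_mono r \<Longrightarrow>
           (\<exists>s::nat \<Rightarrow> nat. \<exists>c'. strict_mono s \<and>
              converges_on_compacts d (c \<circ> r \<circ> s) c' \<and> generalized_ray_to X d p c' x)"
    using assms(1) unfolding gromov_converges_def by blast
  have "\<exists>s::nat \<Rightarrow> nat. \<exists>c'. strict_mono s \<and>
      converges_on_compacts d (c \<circ> r \<circ> q \<circ> s) c' \<and> generalized_ray_to X d p c' x"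
    if "strict_mono q" for q :: "nat \<Rightarrow> nat"
    using sub[OF strict_mono_o[OF assms(2) that]] by (simp add: o_assoc)
  with c show ?thesis
    unfolding gromov_converges_def by (intro exI[of _ "c \<circ> r"]) auto
qed

lemma istopology_gromov_open: "istopology (gromov_open X d p)"
  unfolding istopology_def
proof (intro conjI allI impI)
  fix A B assume A: "gromov_open X d p A" and B: "gromov_open X d p B"
  let ?C = "gromov_closure X d"
  have "x \<notin> A \<inter> B" if xs: "\<forall>n. xs n \<in> ?C - (A \<inter> B)" and x: "x \<in> ?C"
    and conv: "gromov_converges X d p xs x" for xs x
  proof -
    have "infinite {n. xs n \<notin> A} \<or> infinite {n. xs n \<notin> B}"
    proof -
      have "{n. xs n \<notin> A} \<union> {n. xs n \<notin> B} = UNIV" using xs by auto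
      then show ?thesis by (metis finite_Un infinite_UNIV_nat)
    qed
    then obtain D where D: "D = A \<or> D = B" and inf: "infinite {n. xs n \<notin> D}" by blast
    obtain r :: "nat \<Rightarrow> nat" where r: "strict_mono r" "\<And>n. r n \<in> {n. xs n \<notin> D}"
      using infinite_enumerate[OF inf] by blast
    have "\<forall>n. (xs \<circ> r) n \<in> ?C - D" using r(2) xs by auto
    moreover have "gromov_open X d p D" using A B D by blast
    ultimately have "x \<in> ?C - D"
      using gromov_converges_subseq[OF conv r(1)] x unfolding gromov_open_def by blast
    with D show ?thesis by blast
  qed
  then show "gromov_open X d p (A \<inter> B)"
    using A B unfolding gromov_open_def by blast
next
  fix \<K> assume K: "\<forall>K\<in>\<K>. gromov_open X d p K"
  have "x \<notin> \<Union>\<K>" if xs: "\<forall>n. xs n \<in> gromov_closure X d - \<Union>\<K>" and x: "x \<in> gromov_closure X d"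
    and conv: "gromov_converges X d p xs x" for xs x
  proof
    assume "x \<in> \<Union>\<K>"
    then obtain K where "K \<in> \<K>" "x \<in> K" by blast
    moreover have "\<forall>n. xs n \<in> gromov_closure X d - K" using xs \<open>K \<in> \<K>\<close> by blast
    ultimately show False using \<open>\<forall>K\<in>\<K>. gromov_open X d p K\<close> x conv
      unfolding gromov_open_def by blast
  qed
  then show "gromov_open X d p (\<Union>\<K>)"
    using K unfolding gromov_open_def by blast
qed

lemma openin_gromov_compactification:
  "openin (gromov_compactification X d p) = gromov_open X d p"
  unfolding gromov_compactification_def using istopology_gromov_open by (rule topology_inverse')

lemma topspace_gromov_compactification:
  "topspace (gromov_compactification X d p) = gromov_closure X d"
proof -
  have "gromov_open X d p (gromov_closure X d)" by (auto simp: gromov_open_def)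
  moreover have "W \<subseteq> gromov_closure X d" if "gromov_open X d p W" for W
    using that by (auto simp: gromov_open_def)
  ultimately show ?thesis
    unfolding topspace_def openin_gromov_compactification by blast
qed


section \<open>Visibility subspaces and geodesic loops\<close>

definition geodesic_subspace :: "(complex ^ 'n) set \<Rightarrow> (complex ^ 'n) set \<Rightarrow> bool" where
  "geodesic_subspace N S \<longleftrightarrow> S \<subseteq> N \<and> complete_distance_space S (kobayashi_dist N) \<and>
     (\<forall>x\<in>S. \<forall>y\<in>S. x \<noteq> y \<longrightarrow>
        (\<exists>I \<sigma>. geodesic_on N (kobayashi_dist N) I \<sigma> \<and> x \<in> \<sigma> ` I \<and> y \<in> \<sigma> ` I \<and> \<sigma> ` I \<subseteq> S))"

definition ambient_boundary :: "(complex ^ 'n) set \<Rightarrow> (complex ^ 'n) set" where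
  "ambient_boundary S = closure S - S"

definition visibility_subspace :: "(complex ^ 'n) set \<Rightarrow> (complex ^ 'n) set \<Rightarrow> bool" where
  "visibility_subspace N S \<longleftrightarrow> geodesic_subspace N S \<and>
     (\<forall>p\<in>ambient_boundary S. \<forall>q\<in>ambient_boundary S. p \<noteq> q \<longrightarrow>
        (\<exists>U V K. open U \<and> p \<in> U \<and> open V \<and> q \<in> V \<and> closure U \<inter> closure V = {} \<and>
           compact K \<and> K \<subseteq> S \<and>
           (\<forall>a b \<gamma>. a \<le> b \<and> geodesic_on N (kobayashi_dist N) {a..b} \<gamma> \<and> \<gamma> ` {a..b} \<subseteq> S \<and>
                    \<gamma> a \<in> U \<and> \<gamma> b \<in> V \<longrightarrow> \<gamma> ` {a..b} \<inter> K \<noteq> {})))"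

definition limit_points_along ::
  "(real \<Rightarrow> complex ^ 'n) \<Rightarrow> real filter \<Rightarrow> (complex ^ 'n) set \<Rightarrow> (complex ^ 'n) set" where
  "limit_points_along \<gamma> F A =
     {x \<in> A. \<exists>t::nat \<Rightarrow> real. filterlim t F sequentially \<and> (\<lambda>k. \<gamma> (t k)) \<longlonglongrightarrow> x}"

definition geodesic_loop ::
  "(complex ^ 'n) set \<Rightarrow> (complex ^ 'n) set \<Rightarrow> (real \<Rightarrow> complex ^ 'n) \<Rightarrow> bool" where
  "geodesic_loop N S \<gamma> \<longleftrightarrow> geodesic_on S (kobayashi_dist N) UNIV \<gamma> \<and>
     limit_points_along \<gamma> at_top (closure S) = limit_points_along \<gamma> at_bot (closure S)"

end

theory Submission
  imports Defs "HOL-Library.Diagonal_Subsequence"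
begin

text \<open>Geodesic subspaces give geodesics in \<open>M\<close>, so the Hopf--Rinow argument makes the
  complete, locally compact space \<open>M\<close> proper and Arzela--Ascoli applies to its geodesics.
  Along a geodesic ray \<open>f\<close> has a limit, for two distinct cluster points would by visibility
  force arbitrarily late pieces of the ray to return to a fixed compact set; the same argument shows
  that the limit depends only on the asymptotic class and that \<open>f\<close> followed by its limits is
  sequentially continuous. If two non-asymptotic rays had the same limit, hyperbolicity would provide
  a geodesic line joining their endpoints at infinity, and its image would be a geodesic loop.\<close>

section \<open>Proper geodesic spaces\<close>

text \<open>The extension argument is purely metric and lives in the locale
  \<open>visible_embedding\<close>; there the Kobayashi geometry survives only as sequential
  continuity of f and of its inverse. Both come from comparing the Kobayashi distance with the norm.
  On a bounded submanifold the Schwarz lemma bounds the norm by a multiple of the Kobayashi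
  distance, and complex lines in a chart give discs showing that convergence in norm implies
  convergence in the Kobayashi distance. The same comparison provides the local compactness that
  Hopf--Rinow needs. Visibility speaks of finite geodesic segments, whereas ideal points are reached
  by rays. So a ray is cut at a late time at which f is already close to its limit, and
  \<open>endpoint_limit\<close> then treats segments and cut rays alike. Conversely, curves from p
  may converge to a segment or to a ray; which case occurs depends on whether their stopping times
  stay bounded along a subsequence.\<close>

lemma (in Metric_space) tendsto_mdist:
  assumes "\<And>n. x n \<in> M" "\<And>n. y n \<in> M" "a \<in> M" "b \<in> M"
    and "((\<lambda>n. d (x n) a) \<longlongrightarrow> 0) F" "((\<lambda>n. d (y n) b) \<longlongrightarrow> 0) F"
  shows "((\<lambda>n. d (x n) (y n)) \<longlongrightarrow> d a b) F"
proof (rule LIM_zero_cancel, rule tendsto_0_le[where K = 1])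
  show "((\<lambda>n. d (x n) a + d (y n) b) \<longlongrightarrow> 0) F"
    using tendsto_add[OF assms(5,6)] by simp
  have "\<bar>d (x n) (y n) - d a b\<bar> \<le> d (x n) a + d (y n) b" for n
  proof -
    have "d (x n) (y n) \<le> d (x n) a + d a (y n)" "d a (y n) \<le> d a b + d b (y n)"
      "d a b \<le> d a (x n) + d (x n) b" "d (x n) b \<le> d (x n) (y n) + d (y n) b"
      using triangle assms(1-4) by blast+
    then show ?thesis using commute[of a "x n"] commute[of b "y n"] by linarith
  qed
  then show "\<forall>\<^sub>F n in F. norm (d (x n) (y n) - d a b) \<le> norm (d (x n) a + d (y n) b) * 1"
    by simp
qed

lemma (in Metric_space) dist_limit_unique:
  assumes "\<And>n. x n \<in> M" "a \<in> M" "b \<in> M"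
    and "(\<lambda>n. d (x n) a) \<longlonglongrightarrow> 0" "(\<lambda>n. d (x n) b) \<longlonglongrightarrow> 0"
  shows "a = b"
proof -
  have "(\<lambda>n. d (x n) (x n)) \<longlonglongrightarrow> d a b"
    using tendsto_mdist[of x x a b] assms by blast
  then show ?thesis using assms(1-3) LIMSEQ_unique[of "\<lambda>n. 0"] by (simp add: LIMSEQ_const_iff)
qed

text \<open>Properness is stated as a Bolzano--Weierstrass property at one base point, the form in
  which the diagonal extraction below uses it.\<close>

locale proper_geodesic_space = Metric_space X d
  for X :: "'a set" and d :: "'a \<Rightarrow> 'a \<Rightarrow> real" +
  fixes p :: 'a
  assumes base: "p \<in> X"
    and proper: "\<And>(x :: nat \<Rightarrow> 'a) B. \<lbrakk>\<And>n. x n \<in> X; \<And>n. d p (x n) \<le> B\<rbrakk> \<Longrightarrow>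
          \<exists>l\<in>X. \<exists>r. strict_mono r \<and> (\<lambda>n. d (x (r n)) l) \<longlonglongrightarrow> 0"
    and segment: "\<And>x y. \<lbrakk>x \<in> X; y \<in> X\<rbrakk> \<Longrightarrow>
          \<exists>\<sigma>. geodesic_on X d {0..d x y} \<sigma> \<and> \<sigma> 0 = x \<and> \<sigma> (d x y) = y"
begin

text \<open>Arzela--Ascoli: a diagonal sequence converges at every rational time, the common
  Lipschitz bound makes it Cauchy at every real time, and properness supplies a cluster point, to
  which the Cauchy sequence must converge.\<close>

lemma pointwise_lipschitz_subsequence:
  fixes c :: "nat \<Rightarrow> real \<Rightarrow> 'a"
  assumes cX: "\<And>n t. c n t \<in> X" and lip: "\<And>n s t. d (c n s) (c n t) \<le> \<bar>s - t\<bar>"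
    and bd: "\<And>n. d p (c n 0) \<le> B"
  obtains r c' where "strict_mono r" "\<And>t. c' t \<in> X" "\<And>t. (\<lambda>n. d (c (r n) t) (c' t)) \<longlonglongrightarrow> 0"
proof -
  have bdt: "d p (c n t) \<le> B + \<bar>t\<bar>" for n t
    using triangle[of p "c n 0" "c n t"] base cX bd[of n] lip[of n 0 t] by simp
  obtain q :: "nat \<Rightarrow> real" where q: "range q = \<rat>"
    using countable_rat uncountable_def by (metis Rats_0 empty_iff)
  define P where "P k s \<longleftrightarrow> (\<exists>l\<in>X. (\<lambda>n. d (c (s n) (q k)) l) \<longlonglongrightarrow> 0)" for k and s :: "nat \<Rightarrow> nat"
  interpret subseqs P
  proof
    fix n s assume "strict_mono (s::nat\<Rightarrow>nat)"
    obtain l r where "l \<in> X" "strict_mono r" "(\<lambda>k. d (c (s (r k)) (q n)) l) \<longlonglongrightarrow> 0"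
      using proper[of "\<lambda>k. c (s k) (q n)"] cX bdt by blast
    then show "\<exists>r'. strict_mono r' \<and> P n (s \<circ> r')"
      unfolding P_def by auto
  qed
  define r where "r = diagseq"
  have r: "strict_mono r" unfolding r_def by (rule subseq_diagseq)
  \<comment> \<open>From index \<open>Suc k\<close> on, the diagonal sequence is a subsequence of
    the one extracted for \<open>q k\<close>; the shift is removed afterwards, as it does not affect
    limits.\<close>
  have "P k (r \<circ> (+) (Suc k))" for k unfolding r_def
  proof (rule diagseq_holds)
    fix g s :: "nat \<Rightarrow> nat" and n assume "strict_mono g" "P n s"
    then show "P n (s \<circ> g)" unfolding P_def o_def
      using LIMSEQ_subseq_LIMSEQ[unfolded o_def] by blast
  qed
  then have P: "P k r" for k
  proof -
    obtain l where l: "l \<in> X" "(\<lambda>n. d (c ((r \<circ> (+) (Suc k)) n) (q k)) l) \<longlonglongrightarrow> 0"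
      using \<open>P k (r \<circ> (+) (Suc k))\<close> unfolding P_def by blast
    then have "(\<lambda>n. d (c (r (n + Suc k)) (q k)) l) \<longlonglongrightarrow> 0"
      by (simp add: add.commute)
    then show ?thesis unfolding P_def using l(1) LIMSEQ_offset[of "\<lambda>n. d (c (r n) (q k)) l"] by blast
  qed
  have "\<exists>l\<in>X. (\<lambda>n. d (c (r n) t) l) \<longlonglongrightarrow> 0" for t
  proof -
    have cauchy: "MCauchy (\<lambda>n. c (r n) t)"
      unfolding MCauchy_def
    proof (intro conjI allI impI)
      show "range (\<lambda>n. c (r n) t) \<subseteq> X" using cX by auto
      fix e :: real assume "e > 0"
      \<comment> \<open>A rational time within e/4 of t: moving from t to y costs less than e/4 for
        each of the two curves, and comparing each with the limit at y costs another e/4.\<close>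
      obtain y where y: "y \<in> \<rat>" "t < y" "y < t + e/4"
        using Rats_dense_in_real[of t "t + e/4"] \<open>e > 0\<close> by auto
      then obtain k where k: "y = q k" using q by blast
      obtain l where l: "l \<in> X" "(\<lambda>n. d (c (r n) (q k)) l) \<longlonglongrightarrow> 0" using P[of k] unfolding P_def by blast
      then have "\<forall>\<^sub>F n in sequentially. d (c (r n) y) l < e/4"
        using order_tendstoD(2)[OF l(2), of "e/4"] \<open>e > 0\<close> k by simp
      then obtain N where N: "\<And>n. n \<ge> N \<Longrightarrow> d (c (r n) y) l < e/4"
        unfolding eventually_sequentially by blast
      have "d (c (r n) t) (c (r n') t) < e" if "n \<ge> N" "n' \<ge> N" for n n'
      proof -
        have "d (c (r n) t) (c (r n') t) \<le> d (c (r n) t) (c (r n) y) + d (c (r n) y) (c (r n') t)"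
          "d (c (r n) y) (c (r n') t) \<le> d (c (r n) y) l + d l (c (r n') t)"
          "d l (c (r n') t) \<le> d l (c (r n') y) + d (c (r n') y) (c (r n') t)"
          by (intro triangle cX l(1))+
        then show ?thesis
          using N[OF that(1)] N[OF that(2)] lip[of "r n" t y] lip[of "r n'" y t] y
            commute[of l "c (r n') y"] by linarith
      qed
      then show "\<exists>N. \<forall>n n'. N \<le> n \<longrightarrow> N \<le> n' \<longrightarrow> d (c (r n) t) (c (r n') t) < e" by blast
    qed
    obtain l s where "l \<in> X" and s: "strict_mono s" and "(\<lambda>k. d (c (r (s k)) t) l) \<longlonglongrightarrow> 0"
      using proper[of "\<lambda>k. c (r k) t"] cX bdt by blast
    then have "limitin mtopology ((\<lambda>n. c (r n) t) \<circ> s) l sequentially"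
      by (simp add: limitin_metric_dist_null cX o_def)
    then have "limitin mtopology (\<lambda>n. c (r n) t) l sequentially"
      by (rule MCauchy_convergent_subsequence[OF cauchy s])
    then show ?thesis by (auto simp: limitin_metric_dist_null)
  qed
  then obtain c' where "\<And>t. c' t \<in> X" "\<And>t. (\<lambda>n. d (c (r n) t) (c' t)) \<longlonglongrightarrow> 0" by metis
  with r that show ?thesis by blast
qed

text \<open>Pointwise convergence is uniform on a finite e/4-net of the compact set, and the
  Lipschitz bounds, inherited by the limit, carry it to all other points.\<close>

lemma converges_on_compactsI:
  fixes c :: "nat \<Rightarrow> real \<Rightarrow> 'a"
  assumes cX: "\<And>n t. t \<ge> 0 \<Longrightarrow> c n t \<in> X" "\<And>t. t \<ge> 0 \<Longrightarrow> c' t \<in> X"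
    and lip: "\<And>n s t. \<lbrakk>s \<ge> 0; t \<ge> 0\<rbrakk> \<Longrightarrow> d (c n s) (c n t) \<le> \<bar>s - t\<bar>"
    and lim: "\<And>t. t \<ge> 0 \<Longrightarrow> (\<lambda>n. d (c n t) (c' t)) \<longlonglongrightarrow> 0"
  shows "converges_on_compacts d c c'"
  unfolding converges_on_compacts_def
proof (intro allI impI)
  fix K :: "real set" and e :: real assume K: "K \<subseteq> {0..}" "compact K" and e: "e > 0"
  have lip': "d (c' s) (c' t) \<le> \<bar>s - t\<bar>" if "s \<ge> 0" "t \<ge> 0" for s t
  proof (rule LIMSEQ_le_const2)
    show "(\<lambda>n. d (c n s) (c n t)) \<longlonglongrightarrow> d (c' s) (c' t)"
      by (intro tendsto_mdist cX lim that)
  qed (use lip that in blast)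
  have "K \<subseteq> (\<Union>q\<in>K. ball q (e/4))" using e by force
  then obtain Q where Q: "Q \<subseteq> K" "finite Q" "K \<subseteq> (\<Union>q\<in>Q. ball q (e/4))"
    using compactE_image[OF K(2), of K "\<lambda>q. ball q (e/4)"] by auto
  have "\<forall>\<^sub>F n in sequentially. \<forall>q\<in>Q. d (c n q) (c' q) < e/4"
    using order_tendstoD(2)[OF lim, of _ "e/4"] Q K e by (intro eventually_ball_finite) auto
  then show "\<forall>\<^sub>F n in sequentially. \<forall>t\<in>K. d (c n t) (c' t) < e"
  proof (rule eventually_mono, intro ballI)
    fix n t assume n: "\<forall>q\<in>Q. d (c n q) (c' q) < e/4" and t: "t \<in> K"
    obtain q where q: "q \<in> Q" "\<bar>q - t\<bar> < e/4" using Q(3) t by (auto simp: dist_real_def)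
    then have "q \<ge> 0" "t \<ge> 0" using Q(1) K(1) t by auto
    have "d (c n t) (c' t) \<le> d (c n t) (c n q) + d (c n q) (c' t)"
      "d (c n q) (c' t) \<le> d (c n q) (c' q) + d (c' q) (c' t)"
      by (intro triangle cX \<open>q \<ge> 0\<close> \<open>t \<ge> 0\<close>)+
    moreover have "d (c n q) (c' q) < e/4" using n q by blast
    ultimately show "d (c n t) (c' t) < e"
      using q lip[of t q n] lip'[of q t] \<open>q \<ge> 0\<close> \<open>t \<ge> 0\<close> by linarith
  qed
qed

section \<open>Geodesic rays and generalized rays\<close>

lemma geodesic_onD:
  assumes "geodesic_on X d I c"
  shows "s \<in> I \<Longrightarrow> c s \<in> X" "\<lbrakk>s \<in> I; t \<in> I\<rbrakk> \<Longrightarrow> d (c s) (c t) = \<bar>s - t\<bar>"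
  using assms unfolding geodesic_on_def by auto

lemma rayI:
  assumes "\<And>t. t \<ge> 0 \<Longrightarrow> c t \<in> X" "\<And>s t. \<lbrakk>s \<ge> 0; t \<ge> 0\<rbrakk> \<Longrightarrow> d (c s) (c t) = \<bar>s - t\<bar>"
  shows "c \<in> geodesic_rays X d"
  using assms unfolding geodesic_rays_def geodesic_on_def by auto

lemma rayD:
  assumes "c \<in> geodesic_rays X d"
  shows "s \<ge> 0 \<Longrightarrow> c s \<in> X" "\<lbrakk>s \<ge> 0; t \<ge> 0\<rbrakk> \<Longrightarrow> d (c s) (c t) = \<bar>s - t\<bar>"
  using assms unfolding geodesic_rays_def geodesic_on_def by auto

text \<open>In the segment case the constant continuation is absorbed into
  \<open>\<bar>min s R - min t R\<bar>\<close>, valid at all nonnegative times. This formula also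
  passes to limits when R varies.\<close>

lemma generalized_ray_cases:
  assumes "generalized_ray_to X d p c x"
  obtains (ray) "c 0 = p" "c \<in> geodesic_rays X d" "x = Inr (asymptotic_rays X d `` {c})"
  | (seg) R where "c 0 = p" "R \<ge> 0" "x = Inl (c R)" "\<And>t. t \<ge> 0 \<Longrightarrow> c t \<in> X"
      "\<And>s t. \<lbrakk>s \<ge> 0; t \<ge> 0\<rbrakk> \<Longrightarrow> d (c s) (c t) = \<bar>min s R - min t R\<bar>" "d p (c R) = R"
proof -
  consider "c \<in> geodesic_rays X d" "x = Inr (asymptotic_rays X d `` {c})"
    | R where "R \<ge> 0" "geodesic_on X d {0..R} c" "\<And>t. t \<ge> R \<Longrightarrow> c t = c R" "x = Inl (c R)"
    using assms unfolding generalized_ray_to_def by blast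
  then show thesis
  proof cases
    case 1
    then show ?thesis using ray assms unfolding generalized_ray_to_def by blast
  next
    case 2
    have c: "c t = c (min t R)" for t using 2(3)[of t] by (cases "t \<le> R") (auto simp: min_def)
    have X: "c t \<in> X" if "t \<ge> 0" for t
      using geodesic_onD(1)[OF 2(2), of "min t R"] c[of t] 2(1) that by auto
    have D: "d (c s) (c t) = \<bar>min s R - min t R\<bar>" if "s \<ge> 0" "t \<ge> 0" for s t
      using geodesic_onD(2)[OF 2(2), of "min s R" "min t R"] c[of t] c[of s] 2(1) that by auto
    have c0: "c 0 = p" using assms unfolding generalized_ray_to_def by blast
    have "d p (c R) = R" using D[of 0 R] c0 2(1) by simp
    then show ?thesis using seg[OF c0 2(1) 2(4) X D] by blast
  qed
qed

lemma generalized_segmentI: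
  assumes "c 0 = p" "R \<ge> 0" "\<And>t. t \<ge> 0 \<Longrightarrow> c t \<in> X"
    "\<And>s t. \<lbrakk>s \<ge> 0; t \<ge> 0\<rbrakk> \<Longrightarrow> d (c s) (c t) = \<bar>min s R - min t R\<bar>"
  shows "generalized_ray_to X d p c (Inl (c R))"
proof -
  have "c t = c R" if "t \<ge> R" for t
    using assms(4)[of t R] assms(2,3) that zero[of "c t" "c R"] by auto
  moreover have "geodesic_on X d {0..R} c"
    using assms unfolding geodesic_on_def by (auto simp: is_interval_cc)
  ultimately show ?thesis using assms(1,2) unfolding generalized_ray_to_def by blast
qed

lemma generalized_ray_lipschitz:
  assumes "generalized_ray_to X d p c x"
  shows "c 0 = p" "t \<ge> 0 \<Longrightarrow> c t \<in> X" "\<lbrakk>s \<ge> 0; t \<ge> 0\<rbrakk> \<Longrightarrow> d (c s) (c t) \<le> \<bar>s - t\<bar>"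
  using assms
  by (cases rule: generalized_ray_cases; auto simp: rayD)+

lemma generalized_ray_to_closure:
  assumes "generalized_ray_to X d p c x" shows "x \<in> gromov_closure X d"
  using assms
  by (cases rule: generalized_ray_cases)
     (auto simp: gromov_closure_def gromov_boundary_def intro!: quotientI)

lemma generalized_ray_to_point:
  assumes "y \<in> X"
  obtains c where "generalized_ray_to X d p c (Inl y)"
proof -
  obtain \<sigma> where \<sigma>: "geodesic_on X d {0..d p y} \<sigma>" "\<sigma> 0 = p" "\<sigma> (d p y) = y"
    using segment[OF base assms] by blast
  have "generalized_ray_to X d p (\<lambda>t. \<sigma> (min t (d p y))) (Inl (\<sigma> (min (d p y) (d p y))))"
    by (rule generalized_segmentI) (use \<sigma> geodesic_onD[OF \<sigma>(1)] in auto)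
  with \<sigma>(3) that show thesis by simp
qed

text \<open>If infinitely many curves stop before a common time, their stopping times subconverge to
  some R' and the limit curve is a segment stopped at R'. Otherwise every pair of times is
  eventually spanned isometrically and the limit is a ray. The further subsequences only identify
  the limit; convergence holds along \<open>r0\<close> itself.\<close>

lemma generalized_ray_subsequence:
  fixes c :: "nat \<Rightarrow> real \<Rightarrow> 'a"
  assumes "\<And>n. generalized_ray_to X d p (c n) (xs n)"
  obtains r c' x where "strict_mono r" "generalized_ray_to X d p c' x"
    "\<And>t. t \<ge> 0 \<Longrightarrow> (\<lambda>n. d (c (r n) t) (c' t)) \<longlonglongrightarrow> 0"
proof -
  have c0: "c n 0 = p" and cX: "t \<ge> 0 \<Longrightarrow> c n t \<in> X"
    and lip: "\<lbrakk>s \<ge> 0; t \<ge> 0\<rbrakk> \<Longrightarrow> d (c n s) (c n t) \<le> \<bar>s - t\<bar>" for n s t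
    using generalized_ray_lipschitz[OF assms] by blast+
  obtain r0 c' where r0: "strict_mono r0" and c'X: "\<And>t. c' t \<in> X"
    and lim0: "\<And>t. (\<lambda>n. d (c (r0 n) (max 0 t)) (c' t)) \<longlonglongrightarrow> 0"
  \<comment> \<open>Values at negative times are unconstrained; freezing them at the value at 0
    makes the curves 1-Lipschitz on the whole line.\<close>
  proof (rule pointwise_lipschitz_subsequence[of "\<lambda>n t. c n (max 0 t)" 0])
    show "c n (max 0 t) \<in> X" for n t by (intro cX) simp
    show "d (c n (max 0 s)) (c n (max 0 t)) \<le> \<bar>s - t\<bar>" for n s t
      using lip[of "max 0 s" "max 0 t" n] by linarith
    show "d p (c n (max 0 0)) \<le> 0" for n using c0 base by simp
  qed (use that in blast)
  have lim: "(\<lambda>n. d (c (r0 n) t) (c' t)) \<longlonglongrightarrow> 0" if "t \<ge> 0" for t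
    using lim0[of t] that by simp
  have dl: "(\<lambda>n. d (c (r0 n) s) (c (r0 n) t)) \<longlonglongrightarrow> d (c' s) (c' t)" if "s \<ge> 0" "t \<ge> 0" for s t
    by (intro tendsto_mdist cX c'X lim that)
  have c'0: "c' 0 = p"
    using dist_limit_unique[of "\<lambda>n. p" "c' 0" p] lim[of 0] c0 base c'X by simp
  \<comment> \<open>\<open>E n B\<close> expresses, through distances alone, that the n-th curve
    stops at some time R with \<open>R \<le> B\<close>.\<close>
  define E where "E n B \<longleftrightarrow> (\<exists>R\<ge>0. R \<le> B \<and> (\<forall>s\<ge>0. \<forall>t\<ge>0. d (c (r0 n) s) (c (r0 n) t) = \<bar>min s R - min t R\<bar>))"
    for n B
  show thesis
  proof (cases "\<exists>B. \<exists>\<^sub>F n in sequentially. E n B")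
    case True
    then obtain B where "\<exists>\<^sub>F n in sequentially. E n B" by blast
    then have inf: "infinite {n. E n B}"
      by (simp add: frequently_cofinite flip: cofinite_eq_sequentially)
    then obtain s :: "nat \<Rightarrow> nat" where s: "strict_mono s" "\<And>n. E (s n) B"
      using infinite_enumerate[of "{n. E n B}"] by blast
    then obtain R where R: "\<And>n. 0 \<le> R n" "\<And>n. R n \<le> B"
      "\<And>n a b. \<lbrakk>a \<ge> 0; b \<ge> 0\<rbrakk> \<Longrightarrow> d (c (r0 (s n)) a) (c (r0 (s n)) b) = \<bar>min a (R n) - min b (R n)\<bar>"
      unfolding E_def by metis
    have "bounded (range R)" using R(1,2) by (intro boundedI[of _ B]) auto
    then obtain R' u where R': "strict_mono u" "(\<lambda>n. R (u n)) \<longlonglongrightarrow> R'"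
      using bounded_imp_convergent_subsequence[of R] by (auto simp: o_def)
    have R'0: "R' \<ge> 0" using R' R(1) by (intro LIMSEQ_le_const) auto
    have "generalized_ray_to X d p c' (Inl (c' R'))"
    proof (rule generalized_segmentI)
      show "c' 0 = p" "0 \<le> R'" "\<And>t. c' t \<in> X" by fact+
      fix a b :: real assume ab: "a \<ge> 0" "b \<ge> 0"
      have "(\<lambda>n. d (c (r0 (s (u n))) a) (c (r0 (s (u n))) b)) \<longlonglongrightarrow> d (c' a) (c' b)"
        using LIMSEQ_subseq_LIMSEQ[OF dl[OF ab] strict_mono_o[OF s(1) R'(1)]] by (simp add: o_def)
      moreover have "(\<lambda>n. \<bar>min a (R (u n)) - min b (R (u n))\<bar>) \<longlonglongrightarrow> \<bar>min a R' - min b R'\<bar>"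
        by (intro tendsto_intros R')
      ultimately show "d (c' a) (c' b) = \<bar>min a R' - min b R'\<bar>"
        using R(3)[OF ab] LIMSEQ_unique by simp
    qed
    with that r0 lim show thesis by blast
  next
    case False
    have "c' \<in> geodesic_rays X d"
    proof (rule rayI)
      fix s t :: real assume st: "s \<ge> 0" "t \<ge> 0"
      have "\<forall>\<^sub>F n in sequentially. \<not> E n (max s t)"
        using False by (simp add: frequently_def)
      then have "\<forall>\<^sub>F n in sequentially. d (c (r0 n) s) (c (r0 n) t) = \<bar>s - t\<bar>"
      proof eventually_elim
        case (elim n)
        show ?case using assms[of "r0 n"]
        proof (cases rule: generalized_ray_cases)
          case ray then show ?thesis using rayD st by blast
        next
          case (seg R)
          with elim have "\<not> R \<le> max s t" unfolding E_def by blast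
          with seg(5)[OF st] show ?thesis by simp
        qed
      qed
      then have "(\<lambda>n. d (c (r0 n) s) (c (r0 n) t)) \<longlonglongrightarrow> \<bar>s - t\<bar>"
        by (rule tendsto_eventually)
      then show "d (c' s) (c' t) = \<bar>s - t\<bar>" using LIMSEQ_unique dl[OF st] by blast
    qed (use c'X in auto)
    then have "generalized_ray_to X d p c' (Inr (asymptotic_rays X d `` {c'}))"
      using c'0 unfolding generalized_ray_to_def by blast
    with that r0 lim show thesis by blast
  qed
qed

lemma gromov_convergesI:
  assumes c: "\<And>n. generalized_ray_to X d p (c n) (xs n)" and c': "generalized_ray_to X d p c' x"
    and lim: "\<And>t. t \<ge> 0 \<Longrightarrow> (\<lambda>n. d (c n t) (c' t)) \<longlonglongrightarrow> 0"
  shows "gromov_converges X d p xs x"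
  unfolding gromov_converges_def
proof (intro exI[of _ c] conjI allI impI c)
  fix r :: "nat \<Rightarrow> nat" assume r: "strict_mono r"
  have "converges_on_compacts d (c \<circ> r \<circ> id) c'"
  proof (rule converges_on_compactsI)
    fix t :: real assume t: "t \<ge> 0"
    show "(\<lambda>n. d ((c \<circ> r \<circ> id) n t) (c' t)) \<longlonglongrightarrow> 0"
      using LIMSEQ_subseq_LIMSEQ[OF lim[OF t] r] by (simp add: o_def)
  qed (use generalized_ray_lipschitz[OF c] generalized_ray_lipschitz[OF c'] in auto)
  with c' show "\<exists>s c'. strict_mono s \<and> converges_on_compacts d (c \<circ> r \<circ> s) c' \<and> generalized_ray_to X d p c' x"
    by (intro exI[of _ id] exI[of _ c']) (auto simp: strict_mono_id)
qed

lemma converges_on_compactsD: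
  assumes "converges_on_compacts d c c'" "t \<ge> 0"
  shows "(\<lambda>n. d (c n t) (c' t)) \<longlonglongrightarrow> 0"
proof (rule LIMSEQ_I)
  fix e :: real assume "e > 0"
  then have "\<forall>\<^sub>F n in sequentially. \<forall>s\<in>{t}. d (c n s) (c' s) < e"
    using assms unfolding converges_on_compacts_def by auto
  then show "\<exists>no. \<forall>n\<ge>no. norm (d (c n t) (c' t) - 0) < e"
    by (auto simp: eventually_sequentially)
qed

end

section \<open>Rays seen from the base point and the asymptotic relation\<close>

context proper_geodesic_space begin

lemma base_dist_tendsto:
  assumes "\<And>n. x n \<in> X" "a \<in> X" "(\<lambda>n. d (x n) a) \<longlonglongrightarrow> 0"
  shows "(\<lambda>n. d p (x n)) \<longlonglongrightarrow> d p a"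
  using tendsto_mdist[of "\<lambda>n. p" x p a] assms base by simp

lemma ray_dist_base:
  assumes "c \<in> geodesic_rays X d" "t \<ge> 0"
  shows "t - d p (c 0) \<le> d p (c t)" "d p (c t) \<le> t + d p (c 0)"
proof -
  have "c 0 \<in> X" "c t \<in> X" "d (c 0) (c t) = t" using rayD[OF assms(1)] assms(2) by auto
  then show "t - d p (c 0) \<le> d p (c t)" "d p (c t) \<le> t + d p (c 0)"
    using triangle[of "c 0" p "c t"] triangle[of p "c 0" "c t"] base commute[of p "c 0"] by auto
qed

lemma equiv_asymptotic_rays: "equiv (geodesic_rays X d) (asymptotic_rays X d)"
proof (rule equivI)
  show "refl_on (geodesic_rays X d) (asymptotic_rays X d)"
    unfolding asymptotic_rays_def by (intro refl_onI) (auto simp: rayD intro!: exI[of _ 0])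
  show "sym (asymptotic_rays X d)"
    unfolding asymptotic_rays_def sym_def by clarsimp (metis commute)
  show "trans (asymptotic_rays X d)"
  proof (rule transI)
    fix a b c assume ab: "(a, b) \<in> asymptotic_rays X d" and bc: "(b, c) \<in> asymptotic_rays X d"
    obtain A B where AB: "\<forall>t\<ge>0. d (a t) (b t) \<le> A" "\<forall>t\<ge>0. d (b t) (c t) \<le> B"
      using ab bc unfolding asymptotic_rays_def by blast
    have rays: "a \<in> geodesic_rays X d" "b \<in> geodesic_rays X d" "c \<in> geodesic_rays X d"
      using ab bc unfolding asymptotic_rays_def by blast+
    have "d (a t) (c t) \<le> A + B" if "t \<ge> 0" for t
    proof -
      have "d (a t) (c t) \<le> d (a t) (b t) + d (b t) (c t)"
        using triangle rayD(1)[OF rays(1) that] rayD(1)[OF rays(2) that] rayD(1)[OF rays(3) that] by blast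
      with AB that show ?thesis by (meson add_mono order_trans)
    qed
    then show "(a, c) \<in> asymptotic_rays X d" using rays unfolding asymptotic_rays_def by blast
  qed
qed (auto simp: asymptotic_rays_def)

end

section \<open>Gromov hyperbolic spaces\<close>

locale hyperbolic_space = proper_geodesic_space +
  assumes hyperbolic: "gromov_hyperbolic X d"
begin

lemma base_hyperbolic:
  obtains \<delta> where "\<delta> \<ge> 0"
    "\<And>x y z. \<lbrakk>x \<in> X; y \<in> X; z \<in> X\<rbrakk> \<Longrightarrow>
       min (gromov_product d p x y) (gromov_product d p y z) - \<delta> \<le> gromov_product d p x z"
  using hyperbolic base unfolding gromov_hyperbolic_def by blast

text \<open>Along one ray the Gromov product of the points at times s and t is at least
  \<open>min s t\<close> up to the constant D. A single large product far out is therefore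
  propagated back to time t by two uses of hyperbolicity, through the points \<open>c s\<close> and
  \<open>c' u\<close>.\<close>

lemma asymptotic_raysI:
  assumes c: "c \<in> geodesic_rays X d" and c': "c' \<in> geodesic_rays X d"
    and prod: "\<And>B. \<exists>s\<ge>B. \<exists>t\<ge>B. B \<le> gromov_product d p (c s) (c' t)"
  shows "(c, c') \<in> asymptotic_rays X d"
proof -
  obtain \<delta> where \<delta>: "\<delta> \<ge> 0" "\<And>x y z. \<lbrakk>x \<in> X; y \<in> X; z \<in> X\<rbrakk> \<Longrightarrow>
       min (gromov_product d p x y) (gromov_product d p y z) - \<delta> \<le> gromov_product d p x z"
    using base_hyperbolic by blast
  define D where "D = max (d p (c 0)) (d p (c' 0))"
  have along: "min s t - D \<le> gromov_product d p (g s) (g t)"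
    if "g \<in> {c, c'}" "s \<ge> 0" "t \<ge> 0" for g s t
  proof -
    have "g \<in> geodesic_rays X d" "d p (g 0) \<le> D" using that(1) c c' by (auto simp: D_def)
    then show ?thesis
      using ray_dist_base(1)[of g s] ray_dist_base(1)[of g t] rayD(2)[of g s t] that(2,3)
      unfolding gromov_product_def commute[of _ p] by (simp add: min_def field_simps)
  qed
  \<comment> \<open>The product at time t is at least \<open>t - D - 2 * \<delta>\<close>, while
    both distances from p are at most \<open>t + D\<close>; this gives
    \<open>4 * D + 4 * \<delta>\<close>, and the remaining \<open>2 * D\<close> is slack.\<close>
  have "d (c t) (c' t) \<le> 6 * D + 4 * \<delta>" if t: "t \<ge> 0" for t
  proof -
    obtain s u where su: "s \<ge> t" "u \<ge> t" "t \<le> gromov_product d p (c s) (c' u)"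
      using prod by blast
    have X: "c t \<in> X" "c s \<in> X" "c' t \<in> X" "c' u \<in> X" using rayD[OF c] rayD[OF c'] t su by auto
    have D0: "0 \<le> D" by (simp add: D_def le_max_iff_disj)
    have "t - D - \<delta> \<le> gromov_product d p (c t) (c' u)"
      using \<delta>(2)[OF X(1,2,4)] along[of c t s] su t D0 by (simp add: min_def split: if_splits)
    moreover have "t - D \<le> gromov_product d p (c' u) (c' t)"
      using along[of c' u t] su t by (simp add: min_def split: if_splits)
    ultimately have "t - D - 2 * \<delta> \<le> gromov_product d p (c t) (c' t)"
      using \<delta>(2)[OF X(1,4,3)] \<delta>(1) by linarith
    then show ?thesis
      using ray_dist_base(2)[OF c t] ray_dist_base(2)[OF c' t] commute[of p] \<delta>(1) D0
      unfolding gromov_product_def D_def by (simp add: field_simps)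
  qed
  then show ?thesis using c c' unfolding asymptotic_rays_def by blast
qed

text \<open>The new ray is a limit of segments from p to \<open>c (real n)\<close>. A point at
  distance t from p on such a segment has Gromov product exactly t with the far endpoint, so the
  limit has arbitrarily large products with c.\<close>

lemma ray_from_base:
  assumes c: "c \<in> geodesic_rays X d"
  obtains c' where "c' 0 = p" "c' \<in> geodesic_rays X d" "(c, c') \<in> asymptotic_rays X d"
proof -
  define D where "D = d p (c 0)"
  have "\<exists>g. generalized_ray_to X d p g (Inl (c (real n)))" for n
    by (rule generalized_ray_to_point[of "c (real n)"]) (auto intro: rayD(1)[OF c])
  then obtain g where g: "\<And>n. generalized_ray_to X d p (g n) (Inl (c (real n)))" by metis
  have gd: "gromov_product d p (c (real n)) (g n t) = t" "d p (g n t) = t"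
    if "t \<ge> 0" "t \<le> real n - D" for n t
  proof -
    have "gromov_product d p (c (real n)) (g n t) = t \<and> d p (g n t) = t"
      using g[of n]
    proof (cases rule: generalized_ray_cases)
      case (seg R)
      have R: "R = d p (c (real n))" "c (real n) = g n R" using seg(3,6) by auto
      have tR: "t \<le> R" using ray_dist_base(1)[OF c, of "real n"] that(2) R(1) D_def by linarith
      have 1: "d p (g n t) = t" using seg(5)[of 0 t] seg(1,2) tR that(1) by simp
      have 2: "d (g n R) (g n t) = R - t" using seg(5)[of R t] seg(2) tR that(1) by simp
      show ?thesis
        unfolding gromov_product_def R(2) using 1 2 seg(6) commute[of "g n _" p] by simp
    qed auto
    then show "gromov_product d p (c (real n)) (g n t) = t" "d p (g n t) = t" by auto
  qed
  obtain r c' x where r: "strict_mono r" and c': "generalized_ray_to X d p c' x"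
    and lim: "\<And>t. t \<ge> 0 \<Longrightarrow> (\<lambda>n. d (g (r n) t) (c' t)) \<longlonglongrightarrow> 0"
    using generalized_ray_subsequence[of g, OF g] by blast
  note gX = generalized_ray_lipschitz(2)[OF g] and c'X = generalized_ray_lipschitz(2)[OF c']
  have large: "\<forall>\<^sub>F n in sequentially. B \<le> real (r n)" for B
  proof -
    have "\<forall>\<^sub>F n in sequentially. B \<le> real n"
      using filterlim_real_sequentially unfolding filterlim_at_top by blast
    then show ?thesis by eventually_elim (use seq_suble[OF r] in \<open>force intro: order_trans\<close>)
  qed
  have "c' \<in> geodesic_rays X d"
    using c'
  proof (cases rule: generalized_ray_cases)
    case (seg R)
    \<comment> \<open>A limit segment stopped at R would be at distance R from p at time
      \<open>R + 1\<close>, but the approximating segments are eventually at distance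
      \<open>R + 1\<close> there.\<close>
    have "(\<lambda>n. d p (g (r n) (R + 1))) \<longlonglongrightarrow> d p (c' (R + 1))"
      using seg(2) by (intro base_dist_tendsto gX c'X lim) auto
    moreover have "(\<lambda>n. d p (g (r n) (R + 1))) \<longlonglongrightarrow> R + 1"
      using large[of "R + 1 + D"] seg(2)
      by (intro tendsto_eventually) (auto elim!: eventually_mono intro!: gd(2))
    moreover have "d p (c' (R + 1)) = R" using seg(5)[of 0 "R + 1"] seg(1,2) by simp
    ultimately show ?thesis using LIMSEQ_unique by fastforce
  qed auto
  moreover have "(c, c') \<in> asymptotic_rays X d"
  proof (rule asymptotic_raysI[OF c \<open>c' \<in> geodesic_rays X d\<close>])
    fix B :: real
    \<comment> \<open>The extra 1 pays for replacing \<open>g (r n) t\<close> by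
      \<open>c' t\<close>, a move of length less than 1, which lowers a Gromov product by less than
      1.\<close>
    define t where "t = max 0 B + 1"
    have t: "t \<ge> 0" "B \<le> t" "B \<le> t - 1" by (auto simp: t_def)
    have "\<forall>\<^sub>F n in sequentially. d (g (r n) t) (c' t) < 1"
      using order_tendstoD(2)[OF lim[OF t(1)], of 1] by simp
    then have "\<forall>\<^sub>F n in sequentially. d (g (r n) t) (c' t) < 1 \<and> max B (t + D) \<le> real (r n)"
      using large[of "max B (t + D)"] by eventually_elim blast
    then obtain n where n: "d (g (r n) t) (c' t) < 1" "B \<le> real (r n)" "t \<le> real (r n) - D"
      by (fastforce simp: eventually_sequentially)
    let ?c = "c (real (r n))" and ?g = "g (r n) t"
    have X: "?c \<in> X" "?g \<in> X" "c' t \<in> X" using rayD(1)[OF c] gX c'X t by auto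
    have "d ?c (c' t) \<le> d ?c ?g + d ?g (c' t)" "d ?g p \<le> d ?g (c' t) + d (c' t) p"
      using triangle X base by blast+
    then have "gromov_product d p ?c ?g - 1 \<le> gromov_product d p ?c (c' t)"
      using n(1) unfolding gromov_product_def by (simp add: field_simps)
    then have "B \<le> gromov_product d p ?c (c' t)" using gd(1)[OF t(1) n(3)] t by linarith
    with n(2) t(2) show "\<exists>s\<ge>B. \<exists>t\<ge>B. B \<le> gromov_product d p (c s) (c' t)" by blast
  qed
  ultimately show thesis using that generalized_ray_lipschitz(1)[OF c'] by blast
qed

text \<open>Convergence is defined through curves starting at p, while a boundary class may be
  presented by a ray from elsewhere; \<open>ray_from_base\<close> supplies a representative issuing
  from p.\<close>

lemma generalized_ray_exists:
  assumes "x \<in> gromov_closure X d"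
  obtains c where "generalized_ray_to X d p c x"
proof (cases x)
  case (Inl y)
  then show thesis using assms generalized_ray_to_point that unfolding gromov_closure_def by auto
next
  case (Inr A)
  then obtain c where c: "c \<in> geodesic_rays X d" "A = asymptotic_rays X d `` {c}"
    using assms unfolding gromov_closure_def gromov_boundary_def by (auto elim: quotientE)
  obtain c' where "c' 0 = p" "c' \<in> geodesic_rays X d" "(c, c') \<in> asymptotic_rays X d"
    using ray_from_base[OF c(1)] by blast
  moreover from this have "A = asymptotic_rays X d `` {c'}"
    using equiv_class_eq[OF equiv_asymptotic_rays] c(2) by blast
  ultimately show thesis using that Inr unfolding generalized_ray_to_def by blast
qed

lemma gromov_closure_seq_compact:
  fixes xs :: "nat \<Rightarrow> 'a + (real \<Rightarrow> 'a) set"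
  assumes "\<And>n. xs n \<in> gromov_closure X d"
  obtains r x where "strict_mono r" "x \<in> gromov_closure X d" "gromov_converges X d p (xs \<circ> r) x"
proof -
  have "\<exists>c. generalized_ray_to X d p c (xs n)" for n
    by (rule generalized_ray_exists[OF assms]) blast
  then obtain c where c: "\<And>n. generalized_ray_to X d p (c n) (xs n)" by metis
  obtain r c' x where r: "strict_mono r" and c': "generalized_ray_to X d p c' x"
    and lim: "\<And>t. t \<ge> 0 \<Longrightarrow> (\<lambda>n. d (c (r n) t) (c' t)) \<longlonglongrightarrow> 0"
    using generalized_ray_subsequence[of c, OF c] by blast
  have "gromov_converges X d p (xs \<circ> r) x"
    by (rule gromov_convergesI[of "\<lambda>n. c (r n)", OF _ c' lim]) (simp_all add: c)
  then show thesis using that r generalized_ray_to_closure[OF c'] by blast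
qed

text \<open>Rays that are not asymptotic have bounded mutual Gromov products, so geodesics joining far
  points on them pass within a bounded distance of \<open>p\<close> and subconverge to a line.\<close>

lemma line_between_rays:
  assumes c: "c \<in> geodesic_rays X d" and c': "c' \<in> geodesic_rays X d"
    and nasym: "(c, c') \<notin> asymptotic_rays X d"
  obtains \<gamma> \<sigma> a b s where "geodesic_on X d UNIV \<gamma>"
    "\<And>n t. \<sigma> n t \<in> X" "\<And>n. geodesic_on X d {a n..b n} (\<sigma> n)" "\<And>n. a n \<le> 0" "\<And>n. b n \<ge> 0"
    "filterlim a at_bot sequentially" "filterlim b at_top sequentially"
    "filterlim s at_top sequentially" "\<And>n::nat. \<sigma> n (a n) = c (s n)" "\<And>n. \<sigma> n (b n) = c' (s n)"
    "\<And>t. (\<lambda>n. d (\<sigma> n t) (\<gamma> t)) \<longlonglongrightarrow> 0"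
proof -
  obtain \<delta> where \<delta>: "\<delta> \<ge> 0" "\<And>x y z. \<lbrakk>x \<in> X; y \<in> X; z \<in> X\<rbrakk> \<Longrightarrow>
       min (gromov_product d p x y) (gromov_product d p y z) - \<delta> \<le> gromov_product d p x z"
    using base_hyperbolic by blast
  obtain B where B: "\<And>s t. \<lbrakk>s \<ge> B; t \<ge> B\<rbrakk> \<Longrightarrow> gromov_product d p (c s) (c' t) < B"
    using asymptotic_raysI[OF c c'] nasym by (meson not_le)
  \<comment> \<open>The offset \<open>max 0 B\<close> places all sampled times where both rays are
    geodesic and their Gromov products are below B.\<close>
  define s where "s n = max 0 B + real n" for n :: nat
  have s0: "s n \<ge> 0" for n by (simp add: s_def)
  have s_top: "filterlim s at_top sequentially"
    unfolding s_def by (intro filterlim_tendsto_add_at_top[OF tendsto_const] filterlim_real_sequentially)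
  define x where "x n = c (s n)" for n
  define y where "y n = c' (s n)" for n
  have xX: "x n \<in> X" and yX: "y n \<in> X" for n
    using rayD(1)[OF c] rayD(1)[OF c'] s0 by (auto simp: x_def y_def)
  define L where "L n = d (x n) (y n)" for n
  have "\<exists>g. geodesic_on X d {0..L n} g \<and> g 0 = x n \<and> g (L n) = y n" for n
    using segment[OF xX yX] unfolding L_def by blast
  then obtain g where g: "\<And>n. geodesic_on X d {0..L n} (g n)" "\<And>n. g n 0 = x n" "\<And>n. g n (L n) = y n"
    by metis
  \<comment> \<open>The point at time \<open>u n\<close> corresponds to the centre of the comparison
    tripod of p, \<open>x n\<close>, \<open>y n\<close>. Its Gromov products with \<open>x n\<close>
    and with \<open>y n\<close> coincide: both are the mean of its distance from p and the product
    of \<open>x n\<close> and \<open>y n\<close>.\<close>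
  define u where "u n = (d (x n) p + L n - d (y n) p) / 2" for n
  have u: "0 \<le> u n" "u n \<le> L n" for n
    using triangle[of "y n" "x n" p] triangle[of "x n" "y n" p] xX yX base
    by (auto simp: u_def L_def commute field_simps)
  \<comment> \<open>With these equal products the hyperbolic inequality bounds the distance from p
    by the product of the endpoints plus \<open>2 * \<delta>\<close>.\<close>
  define R where "R = B + 2 * \<delta>"
  have near: "d p (g n (u n)) \<le> R" for n
  proof -
    let ?z = "g n (u n)"
    have z: "?z \<in> X" "d (x n) ?z = u n" "d ?z (y n) = L n - u n"
      using geodesic_onD[OF g(1)[of n]] g(2,3)[of n, symmetric] u[of n] by auto
    have "gromov_product d p (x n) (y n) < B" unfolding x_def y_def by (rule B) (auto simp: s_def)
    then show ?thesis
      using \<delta>(2)[OF xX z(1) yX, of n n] z(2,3) unfolding gromov_product_def R_def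
      by (simp add: min_def u_def L_def commute field_simps split: if_splits)
  qed
  define a where "a n = - u n" for n
  define b where "b n = L n - u n" for n
  \<comment> \<open>Shifting places the point near p at time 0, so that the extraction has a bounded
    starting value; clamping makes the curve 1-Lipschitz on the whole line.\<close>
  define \<sigma> where "\<sigma> n t = g n (max 0 (min (t + u n) (L n)))" for n t
  have clamp: "max 0 (min v (L n)) \<in> {0..L n}" for n v using u[of n] by auto
  have \<sigma>X: "\<sigma> n t \<in> X" for n t unfolding \<sigma>_def by (rule geodesic_onD(1)[OF g(1) clamp])
  have \<sigma>_eq: "\<sigma> n t = g n (t + u n)" if "t \<in> {a n..b n}" for n t
    using that unfolding \<sigma>_def a_def b_def by (simp add: max_def min_def)
  have geo: "geodesic_on X d {a n..b n} (\<sigma> n)" for n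
    unfolding geodesic_on_def
  proof (intro conjI ballI)
    show "\<sigma> n ` {a n..b n} \<subseteq> X" using \<sigma>X by auto
    fix v w assume vw: "v \<in> {a n..b n}" "w \<in> {a n..b n}"
    then have "v + u n \<in> {0..L n}" "w + u n \<in> {0..L n}" by (auto simp: a_def b_def)
    then show "d (\<sigma> n v) (\<sigma> n w) = \<bar>v - w\<bar>"
      using \<sigma>_eq vw geodesic_onD(2)[OF g(1), of "v + u n" n "w + u n"] by simp
  qed (simp add: is_interval_cc)
  have lip: "d (\<sigma> n v) (\<sigma> n w) \<le> \<bar>v - w\<bar>" for n v w
    unfolding \<sigma>_def geodesic_onD(2)[OF g(1) clamp clamp] by linarith
  have ends: "\<sigma> n (a n) = x n" "\<sigma> n (b n) = y n" "\<sigma> n 0 = g n (u n)" for n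
    using u[of n] g(2,3)[of n] by (auto simp: \<sigma>_def a_def b_def)
  \<comment> \<open>The endpoints escape while the point at time 0 stays within R of p, so both
    halves of the segments become infinitely long.\<close>
  have far: "s n - (d p (c 0) + R) \<le> u n" "s n - (d p (c' 0) + R) \<le> b n" for n
  proof -
    let ?z = "g n (u n)"
    have z: "?z \<in> X" "d (x n) ?z = u n" "d ?z (y n) = b n"
      using geodesic_onD[OF g(1)[of n]] g(2,3)[of n, symmetric] u[of n] by (auto simp: b_def)
    have "d p (x n) \<le> d p ?z + d ?z (x n)" "d p (y n) \<le> d p ?z + d ?z (y n)"
      using triangle base z(1) xX yX by blast+
    then show "s n - (d p (c 0) + R) \<le> u n" "s n - (d p (c' 0) + R) \<le> b n"
      using ray_dist_base(1)[OF c s0[of n]] ray_dist_base(1)[OF c' s0[of n]] near[of n] z(2,3)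
        commute[of ?z "x n"] by (auto simp: x_def y_def)
  qed
  have top: "filterlim (\<lambda>n. s n - C) at_top sequentially" for C
    using filterlim_tendsto_add_at_top[OF tendsto_const[of "-C"] s_top] by simp
  have u_top: "filterlim u at_top sequentially"
    by (rule filterlim_at_top_mono[OF top[of "d p (c 0) + R"]]) (simp add: far)
  have b_top: "filterlim b at_top sequentially"
    by (rule filterlim_at_top_mono[OF top[of "d p (c' 0) + R"]]) (simp add: far)
  have a_bot: "filterlim a at_bot sequentially"
    using u_top unfolding a_def filterlim_uminus_at_top by simp
  obtain r \<gamma> where r: "strict_mono r" and \<gamma>X: "\<And>t. \<gamma> t \<in> X"
    and lim: "\<And>t. (\<lambda>n. d (\<sigma> (r n) t) (\<gamma> t)) \<longlonglongrightarrow> 0"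
    using pointwise_lipschitz_subsequence[of \<sigma> R, OF \<sigma>X lip] near ends(3) by metis
  have rt: "filterlim r at_top sequentially" using r by (rule filterlim_subseq)
  have "geodesic_on X d UNIV \<gamma>"
    unfolding geodesic_on_def
  proof (intro conjI ballI)
    fix v w
    have "(\<lambda>n. d (\<sigma> (r n) v) (\<sigma> (r n) w)) \<longlonglongrightarrow> d (\<gamma> v) (\<gamma> w)"
      by (intro tendsto_mdist \<sigma>X \<gamma>X lim)
    moreover have "(\<lambda>n. d (\<sigma> (r n) v) (\<sigma> (r n) w)) \<longlonglongrightarrow> \<bar>v - w\<bar>"
    proof (rule tendsto_eventually)
      have "\<forall>\<^sub>F n in sequentially. a (r n) \<le> min v w"
        using filterlim_compose[OF a_bot rt] unfolding filterlim_at_bot by blast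
      moreover have "\<forall>\<^sub>F n in sequentially. max v w \<le> b (r n)"
        using filterlim_compose[OF b_top rt] unfolding filterlim_at_top by blast
      ultimately show "\<forall>\<^sub>F n in sequentially. d (\<sigma> (r n) v) (\<sigma> (r n) w) = \<bar>v - w\<bar>"
        by eventually_elim (intro geodesic_onD(2)[OF geo], auto)
    qed
    ultimately show "d (\<gamma> v) (\<gamma> w) = \<bar>v - w\<bar>" by (rule LIMSEQ_unique)
  qed (use \<gamma>X in auto)
  then show thesis
    using that[of \<gamma> "\<lambda>n. \<sigma> (r n)" "\<lambda>n. a (r n)" "\<lambda>n. b (r n)" "\<lambda>n. s (r n)"]
      \<sigma>X geo lim filterlim_compose[OF a_bot rt] filterlim_compose[OF b_top rt]
      filterlim_compose[OF s_top rt] ends(1,2) u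
    by (simp add: a_def b_def x_def y_def)
qed

end

section \<open>Extension of a visible embedding\<close>

text \<open>A bounded sequence not tending to P has a subsequence outside a ball about P, and that
  one has a convergent further subsequence. This turns visibility, which only separates cluster
  points, into convergence.\<close>

lemma tendsto_if_subsequence_limits:
  fixes y :: "nat \<Rightarrow> 'b::heine_borel"
  assumes "bounded (range y)"
    and uniq: "\<And>r Q. \<lbrakk>strict_mono r; (\<lambda>n. y (r n)) \<longlonglongrightarrow> Q\<rbrakk> \<Longrightarrow> Q = P"
  shows "y \<longlonglongrightarrow> P"
proof (rule ccontr)
  assume "\<not> y \<longlonglongrightarrow> P"
  then obtain e where e: "e > 0" "\<exists>\<^sub>F n in sequentially. \<not> dist (y n) P < e"
    unfolding tendsto_iff frequently_def by auto
  then have "infinite {n. \<not> dist (y n) P < e}"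
    by (simp add: frequently_cofinite flip: cofinite_eq_sequentially)
  then obtain r :: "nat \<Rightarrow> nat" where r: "strict_mono r" "\<And>n. \<not> dist (y (r n)) P < e"
    using infinite_enumerate[of "{n. \<not> dist (y n) P < e}"] by blast
  have "bounded (range (y \<circ> r))"
    using assms(1) by (rule bounded_subset) auto
  then obtain Q s where s: "strict_mono s" "(y \<circ> r \<circ> s) \<longlonglongrightarrow> Q"
    using bounded_imp_convergent_subsequence by blast
  then have "Q = P"
    using uniq[OF strict_mono_o[OF r(1) s(1)], of Q] by (simp add: o_def)
  then have "(\<lambda>n. dist (y (r (s n))) P) \<longlonglongrightarrow> 0"
    using s(2) tendsto_dist_iff[of "y \<circ> r \<circ> s"] by (simp add: o_def)
  then have "\<forall>\<^sub>F n in sequentially. dist (y (r (s n))) P < e"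
    using order_tendstoD(2) e(1) by blast
  with r(2) show False by (auto simp: eventually_sequentially)
qed

text \<open>The compact set in the visibility condition is replaced by a ball of radius B about p,
  which distance estimates along geodesics can exclude directly.\<close>

locale visible_embedding = hyperbolic_space X d p
  for X :: "'a set" and d :: "'a \<Rightarrow> 'a \<Rightarrow> real" and p :: 'a +
  fixes f :: "'a \<Rightarrow> 'b::heine_borel"
  assumes bounded_image: "bounded (f ` X)"
    and continuous: "\<And>(x :: nat \<Rightarrow> 'a) l. \<lbrakk>\<And>n. x n \<in> X; l \<in> X; (\<lambda>n. d (x n) l) \<longlonglongrightarrow> 0\<rbrakk> \<Longrightarrow>
          (\<lambda>n. f (x n)) \<longlonglongrightarrow> f l"
    and inverse_continuous: "\<And>(x :: nat \<Rightarrow> 'a) l. \<lbrakk>\<And>n. x n \<in> X; l \<in> X; (\<lambda>n. f (x n)) \<longlonglongrightarrow> f l\<rbrakk> \<Longrightarrow>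
          (\<lambda>n. d (x n) l) \<longlonglongrightarrow> 0"
    and visible: "\<And>P Q. \<lbrakk>P \<in> closure (f ` X) - f ` X; Q \<in> closure (f ` X) - f ` X; P \<noteq> Q\<rbrakk> \<Longrightarrow>
          \<exists>U V B. open U \<and> P \<in> U \<and> open V \<and> Q \<in> V \<and>
            (\<forall>a b c. a \<le> b \<and> geodesic_on X d {a..b} c \<and> f (c a) \<in> U \<and> f (c b) \<in> V \<longrightarrow>
               (\<exists>t\<in>{a..b}. d p (c t) \<le> B))"
begin

text \<open>If the limit were \<open>f l\<close>, inverse continuity would make the sequence
  converge to l, so its distances from p would stay bounded. This certifies the boundary points to
  which visibility is applied.\<close>

lemma escaping_limit:
  assumes "\<And>n. x n \<in> X" "filterlim (\<lambda>n. d p (x n)) at_top sequentially" "(\<lambda>n. f (x n)) \<longlonglongrightarrow> Q"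
  shows "Q \<in> closure (f ` X) - f ` X"
proof
  show "Q \<in> closure (f ` X)"
    unfolding closure_sequential using assms(1,3) by (intro exI[of _ "\<lambda>n. f (x n)"]) auto
  show "Q \<notin> f ` X"
  proof
    assume "Q \<in> f ` X"
    then obtain l where l: "l \<in> X" "Q = f l" by blast
    then have "(\<lambda>n. d p (x n)) \<longlonglongrightarrow> d p l"
      using inverse_continuous[OF assms(1) l(1)] assms(3) by (intro base_dist_tendsto assms(1)) auto
    with assms(2) show False using not_tendsto_and_filterlim_at_infinity[OF sequentially_bot]
        filterlim_at_top_imp_at_infinity by blast
  qed
qed

section \<open>Limits of f along geodesic rays\<close>

lemma ray_escapes:
  assumes "c \<in> geodesic_rays X d" "filterlim t at_top F" "\<And>n. t n \<ge> 0"
  shows "filterlim (\<lambda>n. d p (c (t n))) at_top F"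
proof (rule filterlim_at_top_mono)
  show "filterlim (\<lambda>n. - d p (c 0) + t n) at_top F"
    using assms(2) by (intro filterlim_tendsto_add_at_top[OF tendsto_const])
  show "\<forall>\<^sub>F n in F. - d p (c 0) + t n \<le> d p (c (t n))"
    using ray_dist_base(1)[OF assms(1,3)] by (intro always_eventually) (simp add: field_simps)
qed

lemma ray_limit_ideal:
  assumes c: "c \<in> geodesic_rays X d" and lim: "((\<lambda>t. f (c t)) \<longlongrightarrow> P) at_top"
  shows "P \<in> closure (f ` X) - f ` X"
proof (rule escaping_limit)
  show "c (real n) \<in> X" for n using rayD(1)[OF c] by simp
  show "filterlim (\<lambda>n. d p (c (real n))) at_top sequentially"
    by (intro ray_escapes c filterlim_real_sequentially) auto
  show "(\<lambda>n. f (c (real n))) \<longlonglongrightarrow> P"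
    using filterlim_compose[OF lim filterlim_real_sequentially] .
qed

lemma ray_limit_exists:
  assumes c: "c \<in> geodesic_rays X d"
  obtains P where "((\<lambda>t. f (c t)) \<longlongrightarrow> P) at_top"
proof -
  have cX: "c t \<in> X" if "t \<ge> 0" for t using rayD(1)[OF c that] .
  have bdd: "bounded (range (\<lambda>n. f (c (t n))))" if "\<And>n. t n \<ge> 0" for t :: "nat \<Rightarrow> real"
    using bounded_image by (rule bounded_subset) (use cX that in auto)
  obtain P q where P: "strict_mono q" "(\<lambda>n. f (c (real (q n)))) \<longlonglongrightarrow> P"
    using bounded_imp_convergent_subsequence[OF bdd[of real]] by (auto simp: o_def)
  have qt: "filterlim (\<lambda>n. real (q n)) at_top sequentially"
    by (rule filterlim_compose[OF filterlim_real_sequentially filterlim_subseq[OF P(1)]])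
  have *: "(\<lambda>n. f (c (t n))) \<longlonglongrightarrow> P" if t: "filterlim t at_top sequentially" "\<And>n. t n \<ge> 0" for t
  proof (rule tendsto_if_subsequence_limits[OF bdd[OF t(2)]])
    fix r Q assume r: "strict_mono (r :: nat \<Rightarrow> nat)" and Q: "(\<lambda>n. f (c (t (r n)))) \<longlonglongrightarrow> Q"
    have tr: "filterlim (\<lambda>n. t (r n)) at_top sequentially"
      by (rule filterlim_compose[OF t(1) filterlim_subseq[OF r]])
    show "Q = P"
    proof (rule ccontr)
      assume "Q \<noteq> P"
      have "Q \<in> closure (f ` X) - f ` X"
        by (rule escaping_limit[OF _ ray_escapes[OF c tr] Q]) (use cX t(2) in auto)
      moreover have "P \<in> closure (f ` X) - f ` X"
        by (rule escaping_limit[OF _ ray_escapes[OF c qt] P(2)]) (use cX in auto)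
      ultimately obtain U V B where UV: "open U" "P \<in> U" "open V" "Q \<in> V" and
        vis: "\<And>a b c. \<lbrakk>a \<le> b; geodesic_on X d {a..b} c; f (c a) \<in> U; f (c b) \<in> V\<rbrakk> \<Longrightarrow>
               \<exists>t\<in>{a..b}. d p (c t) \<le> B"
        using visible[of P Q] \<open>Q \<noteq> P\<close> by metis
      have "\<forall>\<^sub>F n in sequentially. f (c (real (q n))) \<in> U \<and> B + d p (c 0) + 1 \<le> real (q n)"
        using topological_tendstoD[OF P(2) UV(1,2)] qt unfolding filterlim_at_top
        by (intro eventually_conj) blast+
      then obtain n where n: "f (c (real (q n))) \<in> U" "B + d p (c 0) + 1 \<le> real (q n)"
        unfolding eventually_sequentially by blast
      have "\<forall>\<^sub>F m in sequentially. f (c (t (r m))) \<in> V \<and> real (q n) \<le> t (r m)"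
        using topological_tendstoD[OF Q UV(3,4)] tr unfolding filterlim_at_top
        by (intro eventually_conj) blast+
      then obtain m where m: "f (c (t (r m))) \<in> V" "real (q n) \<le> t (r m)"
        unfolding eventually_sequentially by blast
      \<comment> \<open>This piece of c runs from U to V but starts at time at least
        \<open>B + d p (c 0) + 1\<close>, after which c stays at distance greater than B from
        p.\<close>
      have "geodesic_on X d {real (q n)..t (r m)} c"
        using rayD[OF c] unfolding geodesic_on_def by (auto simp: is_interval_cc)
      from vis[OF m(2) this n(1) m(1)] obtain s where "s \<ge> real (q n)" "d p (c s) \<le> B" by auto
      then show False using ray_dist_base(1)[OF c, of s] n(2) by simp
    qed
  qed
  have "((\<lambda>t. f (c t)) \<longlongrightarrow> P) at_top"
  proof (rule tendsto_at_topI_sequentially)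
    fix t :: "nat \<Rightarrow> real" assume t: "filterlim t at_top sequentially"
    then have ev: "\<forall>\<^sub>F n in sequentially. t n \<ge> 0" unfolding filterlim_at_top by blast
    have eq: "\<forall>\<^sub>F n in sequentially. max 0 (t n) = t n" using ev by eventually_elim simp
    have "filterlim (\<lambda>n. max 0 (t n)) at_top sequentially"
      using t eq by (subst filterlim_cong[OF refl refl eq])
    from *[OF this] have "(\<lambda>n. f (c (max 0 (t n)))) \<longlonglongrightarrow> P" by simp
    then show "(\<lambda>n. f (c (t n))) \<longlonglongrightarrow> P"
      by (rule Lim_transform_eventually) (use eq in \<open>eventually_elim; simp\<close>)
  qed
  with that show thesis by blast
qed

text \<open>Visibility is applied to the segment from \<open>c t\<close> to \<open>c' t\<close>. It
  has length at most A, so it stays within A of \<open>c t\<close>, and for t beyond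
  \<open>B + A + d p (c 0)\<close> it misses the ball of radius B.\<close>

lemma asymptotic_rays_same_limit:
  assumes asym: "(c, c') \<in> asymptotic_rays X d"
    and P: "((\<lambda>t. f (c t)) \<longlongrightarrow> P) at_top" and Q: "((\<lambda>t. f (c' t)) \<longlongrightarrow> Q) at_top"
  shows "P = Q"
proof (rule ccontr)
  assume "P \<noteq> Q"
  obtain A where c: "c \<in> geodesic_rays X d" and c': "c' \<in> geodesic_rays X d"
    and A: "\<And>t. t \<ge> 0 \<Longrightarrow> d (c t) (c' t) \<le> A"
    using asym unfolding asymptotic_rays_def by blast
  obtain U V B where UV: "open U" "P \<in> U" "open V" "Q \<in> V" and
    vis: "\<And>a b c. \<lbrakk>a \<le> b; geodesic_on X d {a..b} c; f (c a) \<in> U; f (c b) \<in> V\<rbrakk> \<Longrightarrow>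
               \<exists>t\<in>{a..b}. d p (c t) \<le> B"
    using visible[OF ray_limit_ideal[OF c P] ray_limit_ideal[OF c' Q] \<open>P \<noteq> Q\<close>] by metis
  have "\<forall>\<^sub>F t in at_top. f (c t) \<in> U \<and> f (c' t) \<in> V \<and> max 0 (B + A + d p (c 0) + 1) \<le> t"
    using topological_tendstoD[OF P UV(1,2)] topological_tendstoD[OF Q UV(3,4)]
    by (intro eventually_conj eventually_ge_at_top)
  then obtain t where t: "f (c t) \<in> U" "f (c' t) \<in> V" "max 0 (B + A + d p (c 0) + 1) \<le> t"
    by (auto simp: eventually_at_top_linorder)
  have t0: "t \<ge> 0" using t(3) by simp
  note X = rayD(1)[OF c t0] rayD(1)[OF c' t0]
  obtain \<sigma> where \<sigma>: "geodesic_on X d {0..d (c t) (c' t)} \<sigma>" "\<sigma> 0 = c t" "\<sigma> (d (c t) (c' t)) = c' t"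
    using segment[OF X] by blast
  obtain s where s: "s \<in> {0..d (c t) (c' t)}" "d p (\<sigma> s) \<le> B"
    using vis[OF _ \<sigma>(1)] \<sigma>(2,3) t(1,2) by auto
  have "\<sigma> s \<in> X" "d (\<sigma> 0) (\<sigma> s) = s" using geodesic_onD[OF \<sigma>(1)] s(1) by auto
  then have "d p (c t) \<le> B + A"
    using triangle[OF base, of "\<sigma> s" "c t"] X(1) \<sigma>(2) s A[OF t0] commute[of "c t" "\<sigma> s"] by auto
  then show False using ray_dist_base(1)[OF c t0] t(3) by simp
qed

text \<open>If the limits differed, visibility would force the tails of the geodesics back into a
  fixed ball.\<close>

lemma endpoint_limit:
  fixes \<sigma> :: "nat \<Rightarrow> real \<Rightarrow> 'a"
  assumes \<sigma>: "\<And>n. geodesic_on X d {0..T n} (\<sigma> n)" and \<sigma>X: "\<And>n t. t \<ge> 0 \<Longrightarrow> \<sigma> n t \<in> X"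
    and T: "filterlim T at_top sequentially" "\<And>n. T n \<ge> 0"
    and c: "c \<in> geodesic_rays X d" and conv: "\<And>t. t \<ge> 0 \<Longrightarrow> (\<lambda>n. d (\<sigma> n t) (c t)) \<longlonglongrightarrow> 0"
    and Q: "(\<lambda>n. f (\<sigma> n (T n))) \<longlonglongrightarrow> Q" and P: "((\<lambda>t. f (c t)) \<longlongrightarrow> P) at_top"
  shows "Q = P"
proof (rule ccontr)
  assume "Q \<noteq> P"
  have cX: "c t \<in> X" if "t \<ge> 0" for t using rayD(1)[OF c that] .
  have "(\<lambda>n. d p (\<sigma> n 0)) \<longlonglongrightarrow> d p (c 0)"
    by (rule base_dist_tendsto) (auto intro: \<sigma>X cX conv)
  \<comment> \<open>The starting points converge, hence lie in one ball of radius D about p; this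
    makes the lower bound \<open>far\<close> uniform in n.\<close>
  then have "Bseq (\<lambda>n. d p (\<sigma> n 0))"
    by (intro convergent_imp_Bseq convergentI)
  then obtain D where D: "\<And>n. d p (\<sigma> n 0) \<le> D" unfolding Bseq_def by auto
  have far: "t - D \<le> d p (\<sigma> n t)" if "t \<in> {0..T n}" for n t
  proof -
    have "d (\<sigma> n 0) (\<sigma> n t) = t" using geodesic_onD(2)[OF \<sigma>, of 0 n t] that by auto
    moreover have "d (\<sigma> n 0) (\<sigma> n t) \<le> d (\<sigma> n 0) p + d p (\<sigma> n t)"
      using that by (intro triangle \<sigma>X base) auto
    ultimately show ?thesis using D[of n] commute[of p "\<sigma> n 0"] by linarith
  qed
  have "Q \<in> closure (f ` X) - f ` X"
  proof (rule escaping_limit[OF _ _ Q])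
    show "filterlim (\<lambda>n. d p (\<sigma> n (T n))) at_top sequentially"
    proof (rule filterlim_at_top_mono)
      show "filterlim (\<lambda>n. - D + T n) at_top sequentially"
        by (intro filterlim_tendsto_add_at_top[OF tendsto_const] T)
      show "\<forall>\<^sub>F n in sequentially. - D + T n \<le> d p (\<sigma> n (T n))"
        using far T(2) by (intro always_eventually) (simp add: field_simps)
    qed
  qed (use \<sigma>X T in auto)
  then obtain U V B where UV: "open U" "P \<in> U" "open V" "Q \<in> V" and
    vis: "\<And>a b c. \<lbrakk>a \<le> b; geodesic_on X d {a..b} c; f (c a) \<in> U; f (c b) \<in> V\<rbrakk> \<Longrightarrow>
               \<exists>t\<in>{a..b}. d p (c t) \<le> B"
    using visible[OF ray_limit_ideal[OF c P], of Q] \<open>Q \<noteq> P\<close> by metis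
  have "\<forall>\<^sub>F t in at_top. f (c t) \<in> U \<and> max 0 (B + D + 1) \<le> t"
    using topological_tendstoD[OF P UV(1,2)] by (intro eventually_conj eventually_ge_at_top)
  then obtain s where s: "f (c s) \<in> U" "max 0 (B + D + 1) \<le> s"
    by (auto simp: eventually_at_top_linorder)
  have s0: "s \<ge> 0" using s(2) by simp
  \<comment> \<open>The time s is fixed on the limit ray, with \<open>f (c s)\<close> in U and s
    beyond \<open>B + D\<close>. Convergence at this one time puts the tails from s to
    \<open>T n\<close> in the scope of visibility, though they lie outside the ball.\<close>
  have "(\<lambda>n. f (\<sigma> n s)) \<longlonglongrightarrow> f (c s)"
    by (intro continuous \<sigma>X cX conv s0)
  then have "\<forall>\<^sub>F n in sequentially. f (\<sigma> n s) \<in> U \<and> f (\<sigma> n (T n)) \<in> V \<and> s \<le> T n"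
    using topological_tendstoD[OF _ UV(1) s(1)] topological_tendstoD[OF Q UV(3,4)] T(1)
    unfolding filterlim_at_top by (intro eventually_conj) blast+
  then obtain n where n: "f (\<sigma> n s) \<in> U" "f (\<sigma> n (T n)) \<in> V" "s \<le> T n"
    unfolding eventually_sequentially by blast
  have "geodesic_on X d {s..T n} (\<sigma> n)"
    using geodesic_onD[OF \<sigma>, of _ n] s0 unfolding geodesic_on_def by (auto simp: is_interval_cc)
  from vis[OF n(3) this n(1,2)] obtain t where "s \<le> t" "t \<le> T n" "d p (\<sigma> n t) \<le> B" by auto
  then show False using far[of t n] s(2) s0 by simp
qed

section \<open>The extended map and its sequential continuity\<close>

definition extension :: "'a + (real \<Rightarrow> 'a) set \<Rightarrow> 'b" where
  "extension x = (case x of Inl y \<Rightarrow> f y | Inr A \<Rightarrow> Lim at_top (\<lambda>t. f ((SOME c. c \<in> A) t)))"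

lemma extension_Inl [simp]: "extension (Inl y) = f y"
  by (simp add: extension_def)

text \<open>The representative picked by \<open>SOME\<close> is asymptotic to c, and asymptotic rays
  have the same limit, so the choice does not matter.\<close>

lemma extension_ray:
  assumes c: "c \<in> geodesic_rays X d"
  shows "((\<lambda>t. f (c t)) \<longlongrightarrow> extension (Inr (asymptotic_rays X d `` {c}))) at_top"
proof -
  let ?A = "asymptotic_rays X d `` {c}"
  define g where "g = (SOME c. c \<in> ?A)"
  have "c \<in> ?A" using equiv_class_self[OF equiv_asymptotic_rays c] .
  then have "g \<in> ?A" unfolding g_def some_in_eq by blast
  then have asym: "(c, g) \<in> asymptotic_rays X d" by blast
  then have g: "g \<in> geodesic_rays X d" unfolding asymptotic_rays_def by blast
  obtain P where P: "((\<lambda>t. f (c t)) \<longlongrightarrow> P) at_top" using ray_limit_exists[OF c] .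
  obtain Q where Q: "((\<lambda>t. f (g t)) \<longlongrightarrow> Q) at_top" using ray_limit_exists[OF g] .
  have "extension (Inr ?A) = Q"
    using tendsto_Lim[OF _ Q] by (simp add: extension_def del: Image_singleton_iff flip: g_def)
  with P asymptotic_rays_same_limit[OF asym P Q] show ?thesis by simp
qed

lemma extension_in_closure:
  assumes "x \<in> gromov_closure X d"
  shows "extension x \<in> closure (f ` X)"
proof (cases x)
  case (Inl y)
  then show ?thesis using assms closure_subset[of "f ` X"] by (auto simp: gromov_closure_def)
next
  case (Inr A)
  then obtain c where c: "c \<in> geodesic_rays X d" "A = asymptotic_rays X d `` {c}"
    using assms unfolding gromov_closure_def gromov_boundary_def by (auto elim: quotientE)
  then show ?thesis using ray_limit_ideal[OF c(1) extension_ray[OF c(1)]] Inr by simp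
qed

text \<open>At an interior limit the approximating curves eventually stop before a fixed time, and
  continuity of f suffices. At an ideal limit each curve is cut at a time \<open>T n\<close> where f
  nearly equals the extended value, and \<open>endpoint_limit\<close> applies.\<close>

lemma extension_tendsto:
  assumes conv: "gromov_converges X d p xs x"
  shows "(\<lambda>n. extension (xs n)) \<longlonglongrightarrow> extension x"
proof -
  obtain c where c: "\<And>n. generalized_ray_to X d p (c n) (xs n)"
    and sub: "\<And>r::nat \<Rightarrow> nat. strict_mono r \<Longrightarrow>
           (\<exists>s::nat \<Rightarrow> nat. \<exists>c'. strict_mono s \<and>
              converges_on_compacts d (c \<circ> r \<circ> s) c' \<and> generalized_ray_to X d p c' x)"
    using conv unfolding gromov_converges_def by blast
  show ?thesis
  proof (rule tendsto_if_subsequence_limits)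
    have "range (\<lambda>n. extension (xs n)) \<subseteq> closure (f ` X)"
      using extension_in_closure generalized_ray_to_closure[OF c] by auto
    then show "bounded (range (\<lambda>n. extension (xs n)))"
      using bounded_subset bounded_closure[OF bounded_image] by blast
    fix r Q assume r: "strict_mono (r :: nat \<Rightarrow> nat)" and Q: "(\<lambda>n. extension (xs (r n))) \<longlonglongrightarrow> Q"
    obtain s c' where s: "strict_mono s" and cc: "converges_on_compacts d (c \<circ> r \<circ> s) c'"
      and c': "generalized_ray_to X d p c' x"
      using sub[OF r] by blast
    define g where "g n = c (r (s n))" for n
    define y where "y n = xs (r (s n))" for n
    have g: "generalized_ray_to X d p (g n) (y n)" for n unfolding g_def y_def by (rule c)
    have lim: "(\<lambda>n. d (g n t) (c' t)) \<longlonglongrightarrow> 0" if "t \<ge> 0" for t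
      using converges_on_compactsD[OF cc that] by (simp add: g_def o_def)
    have yQ: "(\<lambda>n. extension (y n)) \<longlonglongrightarrow> Q"
      using LIMSEQ_subseq_LIMSEQ[OF Q s] by (simp add: y_def o_def)
    note gX = generalized_ray_lipschitz(2)[OF g] and c'X = generalized_ray_lipschitz(2)[OF c']
    show "Q = extension x"
      using c'
    proof (cases rule: generalized_ray_cases)
      case (seg R)
      \<comment> \<open>The limit curve is constant after R, so approximating curves move by less
        than 1 between R and \<open>R + 1\<close>. A ray would move by exactly 1; hence they are
        segments stopped before \<open>R + 1\<close>.\<close>
      have eqR: "c' (R + 1) = c' R"
        using seg(5)[of "R + 1" R] seg(2) c'X[of R] c'X[of "R + 1"] by simp
      have "(\<lambda>n. d (g n R) (g n (R + 1))) \<longlonglongrightarrow> d (c' R) (c' (R + 1))"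
        using seg(2) by (intro tendsto_mdist gX c'X lim) auto
      then have "(\<lambda>n. d (g n R) (g n (R + 1))) \<longlonglongrightarrow> 0"
        using eqR c'X[of R] seg(2) by simp
      then have "\<forall>\<^sub>F n in sequentially. d (g n R) (g n (R + 1)) < 1"
        by (rule order_tendstoD(2)) simp
      then have "\<forall>\<^sub>F n in sequentially. f (g n (R + 1)) = extension (y n)"
      proof eventually_elim
        case (elim n)
        show ?case using g[of n]
        proof (cases rule: generalized_ray_cases)
          case ray
          then show ?thesis using rayD(2)[OF ray(2), of R "R + 1"] elim seg(2) by simp
        next
          case s': (seg R')
          have "R' \<le> R + 1" using s'(5)[of R "R + 1"] elim seg(2) by (simp add: min_def split: if_splits)
          then have "g n (R + 1) = g n R'"
            using s'(5)[of "R + 1" R'] s'(2) seg(2) gX[of "R + 1" n] gX[of R' n] by simp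
          then show ?thesis using s'(3) by simp
        qed
      qed
      moreover have "(\<lambda>n. f (g n (R + 1))) \<longlonglongrightarrow> f (c' (R + 1))"
        using seg(2) by (intro continuous gX c'X lim) auto
      ultimately have "(\<lambda>n. extension (y n)) \<longlonglongrightarrow> f (c' (R + 1))"
        by (rule Lim_transform_eventually[rotated])
      then show ?thesis using LIMSEQ_unique[OF yQ] eqR seg(3) by simp
    next
      case ray
      \<comment> \<open>A ray is cut late, at \<open>T \<ge> n\<close>; a segment is taken to its
        end and never leaves the ball of radius T. Either alternative forces \<open>T n\<close> to
        infinity, because the curves converge to a ray.\<close>
      have "\<exists>T\<ge>0. geodesic_on X d {0..T} (g n) \<and> dist (f (g n T)) (extension (y n)) < 1 / real (Suc n) \<and>
              (real n \<le> T \<or> (\<forall>t\<ge>0. d p (g n t) \<le> T))" for n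
        using g[of n]
      proof (cases rule: generalized_ray_cases)
        case ray': ray
        have "\<forall>\<^sub>F T in at_top. dist (f (g n T)) (extension (y n)) < 1 / real (Suc n) \<and> real n \<le> T"
          using tendstoD[OF extension_ray[OF ray'(2)], of "1 / real (Suc n)"] ray'(3)
          by (intro eventually_conj eventually_ge_at_top) auto
        then obtain T where "dist (f (g n T)) (extension (y n)) < 1 / real (Suc n)" "real n \<le> T"
          by (auto simp: eventually_at_top_linorder)
        moreover have "geodesic_on X d {0..T} (g n)"
          using rayD[OF ray'(2)] unfolding geodesic_on_def by (auto simp: is_interval_cc)
        ultimately show ?thesis by (intro exI[of _ T]) auto
      next
        case (seg R)
        have "geodesic_on X d {0..R} (g n)"
          using seg(4,5) unfolding geodesic_on_def by (auto simp: is_interval_cc)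
        moreover have "d p (g n t) \<le> R" if "t \<ge> 0" for t using seg(5)[of 0 t] seg(1,2) that by simp
        ultimately show ?thesis using seg(2,3) by (intro exI[of _ R]) auto
      qed
      then obtain T where T: "\<And>n. T n \<ge> 0" "\<And>n. geodesic_on X d {0..T n} (g n)"
        "\<And>n. dist (f (g n (T n))) (extension (y n)) < 1 / real (Suc n)"
        "\<And>n. real n \<le> T n \<or> (\<forall>t\<ge>0. d p (g n t) \<le> T n)"
        by metis
      have "filterlim T at_top sequentially"
        unfolding filterlim_at_top
      proof
        fix B :: real
        \<comment> \<open>The limit ray is at distance \<open>B' > B\<close> from p at time B', so
          the strict inequality persists for nearby curves.\<close>
        define B' where "B' = max 0 B + 1"
        have B': "B' \<ge> 0" "B < B'" by (auto simp: B'_def)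
        have "(\<lambda>n. d p (g n B')) \<longlonglongrightarrow> d p (c' B')"
          by (intro base_dist_tendsto gX c'X lim B')
        moreover have "d p (c' B') = B'" using rayD(2)[OF ray(2), of 0 B'] ray(1) B'(1) by simp
        ultimately have "\<forall>\<^sub>F n in sequentially. B < d p (g n B')"
          using B'(2) order_tendstoD(1) by simp
        moreover have "\<forall>\<^sub>F n in sequentially. B \<le> real n"
          using filterlim_real_sequentially unfolding filterlim_at_top by blast
        ultimately show "\<forall>\<^sub>F n in sequentially. B \<le> T n"
        proof eventually_elim
          case (elim n)
          then show ?case using T(4)[of n] B'(1) by (meson less_imp_le order_trans)
        qed
      qed
      moreover have "(\<lambda>n. f (g n (T n))) \<longlonglongrightarrow> Q"
      proof -
        have "(\<lambda>n. dist (f (g n (T n))) (extension (y n))) \<longlonglongrightarrow> 0"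
          using T(3) by (intro tendsto_sandwich[OF _ _ tendsto_const LIMSEQ_inverse_real_of_nat])
            (auto intro!: always_eventually simp: less_imp_le inverse_eq_divide)
        then have sum: "(\<lambda>n. dist (f (g n (T n))) (extension (y n)) + dist (extension (y n)) Q) \<longlonglongrightarrow> 0"
          using tendsto_add[OF _ tendsto_dist_iff[THEN iffD1, OF yQ]] by fastforce
        show ?thesis
        proof (rule tendsto_dist_iff[THEN iffD2], rule tendsto_sandwich[OF _ _ tendsto_const sum])
          show "\<forall>\<^sub>F n in sequentially. dist (f (g n (T n))) Q \<le>
              dist (f (g n (T n))) (extension (y n)) + dist (extension (y n)) Q"
            by (intro always_eventually allI dist_triangle)
        qed simp
      qed
      ultimately show ?thesis
        using endpoint_limit[of T g c' Q, OF T(2) gX _ T(1) ray(2) lim _ extension_ray[OF ray(2)]] ray(3) by simp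
    qed
  qed
qed

text \<open>The codomain Y is left free so that the lemma serves both the closure of N and the
  closure of the image.\<close>

lemma continuous_extension:
  assumes "closure (f ` X) \<subseteq> Y"
  shows "continuous_map (gromov_compactification X d p) (top_of_set Y) extension"
  unfolding continuous_map_closedin
proof (intro conjI allI impI)
  show "extension \<in> topspace (gromov_compactification X d p) \<rightarrow> topspace (top_of_set Y)"
    using extension_in_closure assms by (auto simp: topspace_gromov_compactification)
  fix C assume C: "closedin (top_of_set Y) C"
  then obtain T where T: "closed T" "C = Y \<inter> T" by (auto simp: closedin_closed)
  let ?A = "{x \<in> topspace (gromov_compactification X d p). extension x \<in> C}"
  have "gromov_open X d p (gromov_closure X d - ?A)"
    unfolding gromov_open_def
  proof (intro conjI allI impI)
    fix xs x assume "(\<forall>n. xs n \<in> gromov_closure X d - (gromov_closure X d - ?A)) \<and>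
      x \<in> gromov_closure X d \<and> gromov_converges X d p xs x"
    then have xs: "\<And>n. extension (xs n) \<in> C" and x: "x \<in> gromov_closure X d"
      and lim: "(\<lambda>n. extension (xs n)) \<longlonglongrightarrow> extension x"
      using extension_tendsto by auto
    have "extension x \<in> C"
      using closed_sequentially[OF T(1) _ lim] xs assms extension_in_closure[OF x] T(2) by blast
    then show "x \<in> gromov_closure X d - (gromov_closure X d - ?A)"
      using x by (simp add: topspace_gromov_compactification)
  qed auto
  then show "closedin (gromov_compactification X d p) ?A"
    by (auto simp: closedin_def topspace_gromov_compactification openin_gromov_compactification)
qed

text \<open>Closed sets of the compactification are defined by sequences, so sequential compactness
  replaces the usual compact-to-Hausdorff argument.\<close>

lemma closed_image_extension:
  assumes "closedin (gromov_compactification X d p) A"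
  shows "closed (extension ` A)"
  unfolding closed_sequential_limits
proof (intro allI impI)
  have A: "A \<subseteq> gromov_closure X d" "gromov_open X d p (gromov_closure X d - A)"
    using assms unfolding closedin_def topspace_gromov_compactification openin_gromov_compactification
    by auto
  fix y l assume "(\<forall>n. y n \<in> extension ` A) \<and> y \<longlonglongrightarrow> l"
  then have y: "\<forall>n. \<exists>a\<in>A. y n = extension a" and lim: "y \<longlonglongrightarrow> l" by auto
  obtain a where a: "\<And>n. a n \<in> A" "\<And>n. y n = extension (a n)" using y by metis
  obtain r x where r: "strict_mono r" "x \<in> gromov_closure X d" "gromov_converges X d p (a \<circ> r) x"
    using gromov_closure_seq_compact[of a] a(1) A(1) by blast
  have "\<forall>n. (a \<circ> r) n \<in> gromov_closure X d - (gromov_closure X d - A)" using a(1) A(1) by auto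
  then have "x \<in> A" using A(2) r(2,3) unfolding gromov_open_def by blast
  moreover have "(\<lambda>n. y (r n)) \<longlonglongrightarrow> extension x"
    using extension_tendsto[OF r(3)] a(2) by simp
  then have "l = extension x"
    using LIMSEQ_subseq_LIMSEQ[OF lim r(1)] LIMSEQ_unique by (auto simp: o_def)
  ultimately show "l \<in> extension ` A" by blast
qed

text \<open>The segments approximating the line end on the given rays, so f tends to P along their
  endpoints. Applying \<open>endpoint_limit\<close> to the two halves, viewed from time 0,
  identifies both limits of f on the line with P.\<close>

lemma line_with_common_limit:
  assumes c: "c \<in> geodesic_rays X d" and c': "c' \<in> geodesic_rays X d"
    and nasym: "(c, c') \<notin> asymptotic_rays X d"
    and P: "((\<lambda>t. f (c t)) \<longlongrightarrow> P) at_top" "((\<lambda>t. f (c' t)) \<longlongrightarrow> P) at_top"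
  obtains \<gamma> where "geodesic_on X d UNIV \<gamma>"
    "((\<lambda>t. f (\<gamma> t)) \<longlongrightarrow> P) at_top" "((\<lambda>t. f (\<gamma> t)) \<longlongrightarrow> P) at_bot"
proof -
  obtain \<gamma> \<sigma> a b s where \<gamma>: "geodesic_on X d UNIV \<gamma>"
    and \<sigma>X: "\<And>n t. \<sigma> n t \<in> X" and \<sigma>: "\<And>n. geodesic_on X d {a n..b n} (\<sigma> n)"
    and ab: "\<And>n. a n \<le> 0" "\<And>n. b n \<ge> 0"
    and ab_lim: "filterlim a at_bot sequentially" "filterlim b at_top sequentially"
    and s: "filterlim s at_top sequentially" "\<And>n::nat. \<sigma> n (a n) = c (s n)" "\<And>n. \<sigma> n (b n) = c' (s n)"
    and lim: "\<And>t. (\<lambda>n. d (\<sigma> n t) (\<gamma> t)) \<longlonglongrightarrow> 0"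
    by (rule line_between_rays[OF c c' nasym]) (rule that)
  note \<gamma>D = geodesic_onD[OF \<gamma>, simplified]
  have fwd: "\<gamma> \<in> geodesic_rays X d" and bwd: "(\<lambda>t. \<gamma> (- t)) \<in> geodesic_rays X d"
    by (auto intro!: rayI simp: \<gamma>D)
  obtain P1 where P1: "((\<lambda>t. f (\<gamma> t)) \<longlongrightarrow> P1) at_top" using ray_limit_exists[OF fwd] .
  obtain P2 where P2: "((\<lambda>t. f (\<gamma> (- t))) \<longlongrightarrow> P2) at_top" using ray_limit_exists[OF bwd] .
  have "P = P1"
  proof (rule endpoint_limit[OF _ _ ab_lim(2) ab(2) fwd lim _ P1])
    show "geodesic_on X d {0..b n} (\<sigma> n)" for n
      using \<sigma>[of n] ab[of n] unfolding geodesic_on_def by (auto simp: is_interval_cc)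
    show "(\<lambda>n. f (\<sigma> n (b n))) \<longlonglongrightarrow> P"
      using filterlim_compose[OF P(2) s(1)] by (simp add: s(3))
  qed (rule \<sigma>X)
  moreover have "P = P2"
  \<comment> \<open>Time reversal turns the left halves into segments starting at time 0 with
    endpoints \<open>c (s n)\<close>.\<close>
  proof (rule endpoint_limit[of "\<lambda>n. - a n" "\<lambda>n t. \<sigma> n (- t)", OF _ _ _ _ bwd lim _ P2])
    show "geodesic_on X d {0..- a n} (\<lambda>t. \<sigma> n (- t))" for n
      using \<sigma>[of n] ab[of n] unfolding geodesic_on_def by (auto simp: is_interval_cc image_subset_iff)
    show "(\<lambda>n. f (\<sigma> n (- (- a n)))) \<longlonglongrightarrow> P"
      using filterlim_compose[OF P(1) s(1)] by (simp add: s(2))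
    show "filterlim (\<lambda>n. - a n) at_top sequentially"
      using ab_lim(1) by (simp add: filterlim_uminus_at_top)
  qed (use \<sigma>X ab in auto)
  ultimately show thesis using that[OF \<gamma>] P1 P2 by (simp add: filterlim_at_bot_mirror)
qed

theorem homeomorphic_extension:
  assumes noloop: "\<And>\<gamma> P. \<lbrakk>geodesic_on X d UNIV \<gamma>; ((\<lambda>t. f (\<gamma> t)) \<longlongrightarrow> P) at_top\<rbrakk> \<Longrightarrow>
      \<not> ((\<lambda>t. f (\<gamma> t)) \<longlongrightarrow> P) at_bot"
  shows "homeomorphic_map (gromov_compactification X d p) (top_of_set (closure (f ` X))) extension"
proof (rule bijective_closed_imp_homeomorphic_map)
  let ?G = "gromov_compactification X d p"
  show "continuous_map ?G (top_of_set (closure (f ` X))) extension"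
    by (intro continuous_extension order_refl)
  have sub: "extension ` topspace ?G \<subseteq> closure (f ` X)"
    using extension_in_closure by (auto simp: topspace_gromov_compactification)
  show "closed_map ?G (top_of_set (closure (f ` X))) extension"
    unfolding closed_map_def
  proof (intro allI impI)
    fix A assume A: "closedin ?G A"
    then have "extension ` A \<subseteq> closure (f ` X)" using closedin_subset sub by blast
    then show "closedin (top_of_set (closure (f ` X))) (extension ` A)"
      using closed_image_extension[OF A] by (simp add: closed_subset)
  qed
  have "f ` X \<subseteq> extension ` topspace ?G"
  proof
    fix z assume "z \<in> f ` X"
    then obtain x where "x \<in> X" "z = extension (Inl x)" by auto
    then show "z \<in> extension ` topspace ?G"
      by (auto simp: topspace_gromov_compactification gromov_closure_def simp del: extension_Inl)
  qed
  \<comment> \<open>Surjectivity needs no explicit preimages: the image of the whole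
    compactification is closed and contains the image of X.\<close>
  then have "closure (f ` X) \<subseteq> extension ` topspace ?G"
    by (intro closure_minimal closed_image_extension closedin_topspace)
  with sub show "extension ` topspace ?G = topspace (top_of_set (closure (f ` X)))" by simp
  show "inj_on extension (topspace ?G)"
    unfolding topspace_gromov_compactification
  proof (rule inj_onI)
    fix x y assume xy: "x \<in> gromov_closure X d" "y \<in> gromov_closure X d" "extension x = extension y"
    \<comment> \<open>Ideal points take values outside the image of X, which settles the mixed
      cases; two ideal points are compared through rays representing them.\<close>
    have Inr: "\<exists>c\<in>geodesic_rays X d. A = asymptotic_rays X d `` {c} \<and>
        ((\<lambda>t. f (c t)) \<longlongrightarrow> extension (Inr A)) at_top \<and> extension (Inr A) \<notin> f ` X"
      if A: "Inr A \<in> gromov_closure X d" for A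
    proof -
      obtain c where "c \<in> geodesic_rays X d" "A = asymptotic_rays X d `` {c}"
        using A unfolding gromov_closure_def gromov_boundary_def by (auto elim: quotientE)
      then show ?thesis using extension_ray[of c] ray_limit_ideal[of c] by (intro bexI[of _ c]) auto
    qed
    have Inl: "a \<in> X" if "Inl a \<in> gromov_closure X d" for a
      using that by (auto simp: gromov_closure_def)
    show "x = y"
    proof (cases x; cases y)
      fix a b assume ab: "x = Inl a" "y = Inl b"
      then have "a \<in> X" "b \<in> X" "f a = f b" using xy Inl by auto
      \<comment> \<open>Injectivity of f is inverse continuity applied to the constant sequence
        a.\<close>
      then have "(\<lambda>n::nat. d a b) \<longlonglongrightarrow> 0" using inverse_continuous[of "\<lambda>n. a" b] by simp
      then show ?thesis using ab \<open>a \<in> X\<close> \<open>b \<in> X\<close> by (simp add: LIMSEQ_const_iff)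
    next
      fix a B assume "x = Inl a" "y = Inr B"
      then have "extension (Inr B) \<in> f ` X" using xy Inl[of a] by (metis extension_Inl imageI)
      with \<open>y = Inr B\<close> show ?thesis using xy Inr[of B] by blast
    next
      fix A b assume "x = Inr A" "y = Inl b"
      then have "extension (Inr A) \<in> f ` X" using xy Inl[of b] by (metis extension_Inl imageI)
      with \<open>x = Inr A\<close> show ?thesis using xy Inr[of A] by blast
    next
      fix A B assume AB: "x = Inr A" "y = Inr B"
      obtain c where c: "c \<in> geodesic_rays X d" "A = asymptotic_rays X d `` {c}"
        "((\<lambda>t. f (c t)) \<longlongrightarrow> extension (Inr A)) at_top" using Inr[of A] xy AB by blast
      obtain c' where c': "c' \<in> geodesic_rays X d" "B = asymptotic_rays X d `` {c'}"
        "((\<lambda>t. f (c' t)) \<longlongrightarrow> extension (Inr A)) at_top" using Inr[of B] xy AB by auto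
      have "(c, c') \<in> asymptotic_rays X d"
      proof (rule ccontr)
        assume "(c, c') \<notin> asymptotic_rays X d"
        from line_with_common_limit[OF c(1) c'(1) this c(3) c'(3)] noloop show False by metis
      qed
      then show ?thesis using AB c(2) c'(2) equiv_class_eq[OF equiv_asymptotic_rays] by blast
    qed
  qed
qed

end

section \<open>The Hopf--Rinow argument\<close>

text \<open>Let R be the supremum of the radii with totally bounded ball. The radius R is itself
  attained; completeness then makes that ball compact, so local total boundedness is uniform on it,
  and the radius can be enlarged beyond R.\<close>

lemma (in Metric_space) hopf_rinow_totally_bounded:
  assumes complete: "mcomplete" and p: "p \<in> M"
    and loc: "\<And>x. x \<in> M \<Longrightarrow> \<exists>e>0. mtotally_bounded (mball x e)"
    and between: "\<And>x y s. \<lbrakk>x \<in> M; y \<in> M; 0 \<le> s; s \<le> d x y\<rbrakk> \<Longrightarrow> \<exists>z\<in>M. d x z = s \<and> d z y = d x y - s"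
  shows "mtotally_bounded (mcball p r)"
proof (rule ccontr)
  assume neg: "\<not> mtotally_bounded (mcball p r)"
  define A where "A = {s. 0 \<le> s \<and> mtotally_bounded (mcball p s)}"
  have mono: "mtotally_bounded (mcball p s')" if "mtotally_bounded (mcball p s)" "s' \<le> s" for s s'
    by (rule mtotally_bounded_subset[OF that(1)]) (use that(2) in auto)
  have "mcball p 0 = {p}"
  proof (intro equalityI subsetI)
    fix x assume "x \<in> mcball p 0"
    then have "x \<in> M" "d p x = 0" using nonneg[of p x] by auto
    then show "x \<in> {p}" using p by simp
  qed (use p in simp)
  then have A0: "0 \<in> A" unfolding A_def using p by simp
  have bdd: "bdd_above A"
    using mono neg unfolding A_def bdd_above_def by (metis (mono_tags, lifting) linear mem_Collect_eq)
  define R where "R = Sup A"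
  have R0: "0 \<le> R" unfolding R_def using A0 bdd by (rule cSup_upper)
  have below: "mtotally_bounded (mcball p s)" if "s < R" for s
    using that A0 less_cSupE[of s A] mono unfolding R_def A_def by (metis (mono_tags, lifting) empty_iff less_imp_le mem_Collect_eq)
  have R: "mtotally_bounded (mcball p R)"
  proof (cases "R = 0")
    case True
    then show ?thesis using A0 unfolding A_def by simp
  next
    case False
    show ?thesis unfolding mtotally_bounded_def
    proof (intro allI impI)
      fix e :: real assume e: "e > 0"
      \<comment> \<open>By \<open>between\<close>, points of the ball of radius R lie within e/2 of
        the ball of radius s, so an e/2-net of the smaller ball is an e-net of the larger. The
        maximum with 0 keeps s an admissible distance.\<close>
      define s where "s = max 0 (R - e/2)"
      have s: "s < R" "0 \<le> s" "R - s \<le> e/2" using False R0 e by (auto simp: s_def max_def)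
      obtain K where K: "finite K" "K \<subseteq> mcball p s" "mcball p s \<subseteq> (\<Union>x\<in>K. mball x (e/2))"
        using below[OF s(1)] e unfolding mtotally_bounded_def by (meson half_gt_zero)
      have "mcball p R \<subseteq> (\<Union>x\<in>K. mball x e)"
      proof
        fix y assume "y \<in> mcball p R"
        then have y: "y \<in> M" "d p y \<le> R" by auto
        obtain z where z: "z \<in> M" "d p z \<le> s" "d z y \<le> e/2"
        proof (cases "d p y \<le> s")
          case True
          then show ?thesis using that[of y] y(1) e by simp
        next
          case False
          then obtain z where "z \<in> M" "d p z = s" "d z y = d p y - s"
            using between[OF p y(1), of s] s by auto
          then show ?thesis using that[of z] y(2) s(3) by simp
        qed
        then obtain x where x: "x \<in> K" "x \<in> M" "d x z < e/2" using K(3) p by fastforce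
        have "d x y < e" using triangle[OF x(2) z(1) y(1)] x(3) z(3) by simp
        then show "y \<in> (\<Union>x\<in>K. mball x e)" using x y by auto
      qed
      moreover have "K \<subseteq> mcball p R" using K(2) s(1) by auto
      ultimately show "\<exists>K. finite K \<and> K \<subseteq> mcball p R \<and> mcball p R \<subseteq> (\<Union>x\<in>K. mball x e)"
        using K(1) by blast
    qed
  qed
  obtain e where e: "\<And>x. x \<in> M \<Longrightarrow> e x > 0" "\<And>x. x \<in> M \<Longrightarrow> mtotally_bounded (mball x (e x))"
    using loc by metis
  have "compactin mtopology (mcball p R)"
    using R mtotally_bounded_eq_compact_closure_of[OF complete] closure_of_closedin[OF closedin_mcball] by simp
  \<comment> \<open>A Lebesgue number of the cover by totally bounded balls: every \<epsilon>-ball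
    centred in the compact ball is totally bounded.\<close>
  then obtain \<epsilon> where \<epsilon>: "\<epsilon> > 0" "\<And>x. x \<in> mcball p R \<Longrightarrow> \<exists>U\<in>(\<lambda>x. mball x (e x)) ` M. mball x \<epsilon> \<subseteq> U"
    using lebesgue_number[of "mcball p R" "(\<lambda>x. mball x (e x)) ` M"] e(1) by (force intro: openin_mball)
  obtain K where K: "finite K" "K \<subseteq> mcball p R" "mcball p R \<subseteq> (\<Union>x\<in>K. mball x (\<epsilon>/2))"
    using R \<epsilon>(1) unfolding mtotally_bounded_def by (meson half_gt_zero)
  have "mtotally_bounded (\<Union>((\<lambda>x. mball x \<epsilon>) ` K))"
  proof (rule mtotally_bounded_Union)
    fix S assume "S \<in> (\<lambda>x. mball x \<epsilon>) ` K"
    then obtain x where "x \<in> mcball p R" "S = mball x \<epsilon>" using K(2) by blast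
    then show "mtotally_bounded S" using \<epsilon>(2) e(2) mtotally_bounded_subset by blast
  qed (use K(1) in simp)
  \<comment> \<open>A point of the enlarged ball is within \<epsilon>/4 of the ball of radius R,
    hence within 3\<epsilon>/4 of a point of K.\<close>
  moreover have "mcball p (R + \<epsilon>/4) \<subseteq> \<Union>((\<lambda>x. mball x \<epsilon>) ` K)"
  proof
    fix y assume "y \<in> mcball p (R + \<epsilon>/4)"
    then have y: "y \<in> M" "d p y \<le> R + \<epsilon>/4" by auto
    obtain z where z: "z \<in> M" "d p z \<le> R" "d z y \<le> \<epsilon>/4"
    proof (cases "d p y \<le> R")
      case True
      then show ?thesis using that[of y] y(1) \<epsilon>(1) by simp
    next
      case False
      then obtain z where "z \<in> M" "d p z = R" "d z y = d p y - R"
        using between[OF p y(1), of R] R0 by auto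
      then show ?thesis using that[of z] y(2) by simp
    qed
    then obtain x where x: "x \<in> K" "x \<in> M" "d x z < \<epsilon>/2" using K(3) p by fastforce
    have "d x y < \<epsilon>" using triangle[OF x(2) z(1) y(1)] x(3) z(3) \<epsilon>(1) by simp
    then show "y \<in> \<Union>((\<lambda>x. mball x \<epsilon>) ` K)" using x y by auto
  qed
  ultimately have "R + \<epsilon>/4 \<in> A"
    unfolding A_def using mtotally_bounded_subset R0 \<epsilon>(1) by simp
  then have "R + \<epsilon>/4 \<le> R" unfolding R_def by (rule cSup_upper[OF _ bdd])
  with \<epsilon>(1) show False by simp
qed

section \<open>Comparison of the Kobayashi distance with the norm\<close>

text \<open>The inequality \<open>ln y \<le> y - 1\<close> at \<open>y = (1 - x) / (1 + x)\<close>
  gives the factor 1/2, which reappears in the constant 6 below.\<close>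

lemma half_le_artanh:
  assumes "0 \<le> x" "x < 1" shows "x / 2 \<le> artanh (x :: real)"
proof -
  have "ln ((1 - x) / (1 + x)) \<le> (1 - x) / (1 + x) - 1"
    using assms by (intro ln_le_minus_one) auto
  also have "\<dots> \<le> - x"
    using assms mult_left_le[of x x] by (simp add: field_simps)
  finally have "x \<le> ln ((1 + x) / (1 - x))"
    using assms by (simp add: ln_div)
  then show ?thesis by (simp add: artanh_def)
qed

lemma poincare_dist_Moebius: "poincare_dist a b = artanh (norm (Moebius_function 0 b a))"
  by (simp add: poincare_dist_def Moebius_function_simple)

text \<open>A disc automorphism moves b to 0; the Schwarz lemma for the rescaled function bounds the
  increment by \<open>3 * R\<close> times the pseudohyperbolic distance, which is at most twice the
  Poincare distance.\<close>

lemma holomorphic_disc_comp_bound: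
  assumes hol: "g holomorphic_on ball 0 1" and R: "R > 0" "\<And>z. norm z < 1 \<Longrightarrow> norm (g z) \<le> R"
    and ab: "norm a < 1" "norm b < 1"
  shows "norm (g a - g b) \<le> 6 * R * poincare_dist a b"
proof -
  define \<xi> where "\<xi> = Moebius_function 0 b a"
  \<comment> \<open>\<open>3 * R\<close> rather than \<open>2 * R\<close> makes the bound strict, as the Schwarz lemma requires\<close>
  define h where "h z = (g (Moebius_function 0 (-b) z) - g b) / (3 * of_real R)" for z
  have mob: "norm (Moebius_function 0 (-b) z) < 1" if "norm z < 1" for z
    using ab that by (intro Moebius_function_norm_lt_1) auto
  have "h holomorphic_on ball 0 1"
  proof -
    have "Moebius_function 0 (-b) holomorphic_on ball 0 1"
      using ab by (intro Moebius_function_holomorphic) simp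
    then have "(g \<circ> Moebius_function 0 (-b)) holomorphic_on ball 0 1"
      by (rule holomorphic_on_compose_gen[OF _ hol]) (use mob in auto)
    then have "(\<lambda>z. g (Moebius_function 0 (-b) z)) holomorphic_on ball 0 1"
      unfolding o_def .
    then show ?thesis
      unfolding h_def using R(1) by (intro holomorphic_intros) auto
  qed
  moreover have "h 0 = 0" by (simp add: h_def Moebius_function_of_zero)
  moreover have "norm (h z) < 1" if "norm z < 1" for z
  proof -
    have "norm (g (Moebius_function 0 (-b) z) - g b) \<le> R + R"
      using R(2)[OF mob[OF that]] R(2)[OF ab(2)] by (intro norm_triangle_le_diff add_mono)
    then show ?thesis using R(1) by (simp add: h_def norm_divide norm_mult)
  qed
  moreover have \<xi>: "norm \<xi> < 1" unfolding \<xi>_def using ab by (intro Moebius_function_norm_lt_1)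
  ultimately have "norm (h \<xi>) \<le> norm \<xi>" by (rule Schwarz_Lemma)
  moreover have "Moebius_function 0 (-b) \<xi> = a"
    unfolding \<xi>_def using ab by (intro Moebius_function_compose) auto
  ultimately have "norm (g a - g b) \<le> 3 * R * norm \<xi>"
    using R(1) by (simp add: h_def norm_divide norm_mult field_simps)
  also have "\<dots> \<le> 3 * R * (2 * poincare_dist a b)"
    using half_le_artanh[OF norm_ge_zero \<xi>] R(1)
    by (intro mult_left_mono) (auto simp: poincare_dist_Moebius \<xi>_def)
  finally show ?thesis by simp
qed

text \<open>The one-variable bound is applied to each coordinate; bounding the Euclidean norm by the
  sum of coordinate norms produces the dimension factor.\<close>

lemma holomorphic_disc_bound:
  fixes M :: "(complex ^ 'm) set"
  assumes "holomorphic_disc M \<phi>" and R: "R > 0" "\<And>x. x \<in> M \<Longrightarrow> norm x \<le> R"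
    and ab: "a \<in> ball 0 1" "b \<in> ball 0 1"
  shows "norm (\<phi> a - \<phi> b) \<le> real CARD('m) * (6 * R) * poincare_dist a b"
proof -
  have "norm (\<phi> z $ i) \<le> R" if "norm z < 1" for z i
  proof -
    have "\<phi> z \<in> M" using assms(1) that unfolding holomorphic_disc_def by auto
    then show ?thesis using Finite_Cartesian_Product.norm_nth_le[of "\<phi> z" i] R(2) order_trans by blast
  qed
  then have "norm ((\<phi> a - \<phi> b) $ i) \<le> 6 * R * poincare_dist a b" for i
    using holomorphic_disc_comp_bound[of "\<lambda>z. \<phi> z $ i" R a b] assms(1) R(1) ab
    unfolding holomorphic_disc_def by simp
  then have "(\<Sum>i\<in>UNIV. norm ((\<phi> a - \<phi> b) $ i)) \<le> real CARD('m) * (6 * R * poincare_dist a b)"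
    by (rule sum_bounded_above)
  then show ?thesis
    using L2_set_le_sum[of UNIV "\<lambda>i. norm ((\<phi> a - \<phi> b) $ i)"]
    by (simp add: norm_vec_def mult.assoc)
qed

lemma kobayashi_chain_length_bound:
  fixes M :: "(complex ^ 'm) set"
  assumes "kobayashi_chain_length M p q L" and R: "R > 0" "\<And>x. x \<in> M \<Longrightarrow> norm x \<le> R"
  shows "norm (p - q) \<le> real CARD('m) * (6 * R) * L"
proof -
  obtain k x \<phi> a b where x: "x 0 = p" "x k = q" and
    disc: "\<And>j. j < k \<Longrightarrow> holomorphic_disc M (\<phi> j) \<and> a j \<in> ball 0 1 \<and> b j \<in> ball 0 1 \<and>
               \<phi> j (a j) = x j \<and> \<phi> j (b j) = x (Suc j)"
    and L: "L = (\<Sum>j<k. poincare_dist (a j) (b j))"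
    using assms(1) unfolding kobayashi_chain_length_def by blast
  have "n \<le> k \<Longrightarrow> norm (x 0 - x n) \<le> real CARD('m) * (6 * R) * (\<Sum>j<n. poincare_dist (a j) (b j))" for n
  proof (induction n)
    case (Suc n)
    have "norm (x n - x (Suc n)) \<le> real CARD('m) * (6 * R) * poincare_dist (a n) (b n)"
      using disc[of n] holomorphic_disc_bound[of M "\<phi> n" R "a n" "b n"] R Suc.prems by auto
    then show ?case
      using norm_triangle_ineq[of "x 0 - x n" "x n - x (Suc n)"] Suc by (simp add: distrib_left)
  qed simp
  then show ?thesis using x L by blast
qed

text \<open>A single link of a Kobayashi chain, isolated so that chains can be built by induction
  and links can generate an equivalence relation.\<close>

definition disc_step :: "(complex ^ 'm) set \<Rightarrow> complex ^ 'm \<Rightarrow> complex ^ 'm \<Rightarrow> real \<Rightarrow> bool" where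
  "disc_step M x y L \<longleftrightarrow> (\<exists>\<phi> a b. holomorphic_disc M \<phi> \<and> a \<in> ball 0 1 \<and> b \<in> ball 0 1 \<and>
     \<phi> a = x \<and> \<phi> b = y \<and> poincare_dist a b = L)"

lemma kobayashi_chain_length_refl: "kobayashi_chain_length M p p 0"
  unfolding kobayashi_chain_length_def by (rule exI[of _ 0]) auto

lemma kobayashi_chain_length_append:
  assumes "kobayashi_chain_length M p q L" "disc_step M q r l"
  shows "kobayashi_chain_length M p r (L + l)"
proof -
  obtain k x \<phi> a b where x: "x 0 = p" "x k = q" and
    disc: "\<And>j. j < k \<Longrightarrow> holomorphic_disc M (\<phi> j) \<and> a j \<in> ball 0 1 \<and> b j \<in> ball 0 1 \<and>
               \<phi> j (a j) = x j \<and> \<phi> j (b j) = x (Suc j)"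
    and L: "L = (\<Sum>j<k. poincare_dist (a j) (b j))"
    using assms(1) unfolding kobayashi_chain_length_def by blast
  obtain \<phi>' a' b' where step: "holomorphic_disc M \<phi>'" "a' \<in> ball 0 1" "b' \<in> ball 0 1"
     "\<phi>' a' = q" "\<phi>' b' = r" "poincare_dist a' b' = l"
    using assms(2) unfolding disc_step_def by blast
  show ?thesis
    unfolding kobayashi_chain_length_def
    by (rule exI[of _ "Suc k"], rule exI[of _ "x(Suc k := r)"], rule exI[of _ "\<phi>(k := \<phi>')"],
        rule exI[of _ "a(k := a')"], rule exI[of _ "b(k := b')"])
      (use x disc L step in \<open>auto simp: less_Suc_eq\<close>)
qed

section \<open>Charts, short discs and the topology of the Kobayashi distance\<close>

lemma norm_vector_scalar_mult: "norm (c *s v) = norm c * norm (v :: complex ^ 'm)"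
  by (simp add: norm_vec_def norm_mult L2_set_right_distrib)

text \<open>Complex linearity of the derivative A turns \<open>A (h *s v) $ i\<close> into
  multiplication of h by \<open>A v $ i\<close>, so the real derivative along the line is a complex
  one.\<close>

lemma holomorphic_disc_chart:
  fixes \<psi> :: "complex ^ 'm \<Rightarrow> complex ^ 'm"
  assumes hol: "holomorphic_map_on \<psi> V" and V: "\<And>z. norm z < 1 \<Longrightarrow> w + z *s v \<in> V"
    and M: "\<And>z. norm z < 1 \<Longrightarrow> \<psi> (w + z *s v) \<in> M"
  shows "holomorphic_disc M (\<lambda>z. \<psi> (w + z *s v))"
  unfolding holomorphic_disc_def
proof (intro conjI allI)
  fix i
  show "(\<lambda>z. \<psi> (w + z *s v) $ i) holomorphic_on ball 0 1"
  proof (rule holomorphic_onI)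
    fix z :: complex assume "z \<in> ball 0 1"
    then have "w + z *s v \<in> V" using V by simp
    then obtain A where A: "(\<psi> has_derivative A) (at (w + z *s v))" "\<And>c v. A (c *s v) = c *s A v"
      using hol unfolding holomorphic_map_on_def by blast
    have "linear (\<lambda>h::complex. h *s v)"
      by (intro linearI) (auto simp: vec_eq_iff algebra_simps)
    then have "bounded_linear (\<lambda>h::complex. h *s v)" by (simp add: linear_conv_bounded_linear)
    then have "((\<lambda>z. w + z *s v) has_derivative (\<lambda>h. h *s v)) (at z)"
      using has_derivative_add[OF has_derivative_const bounded_linear_imp_has_derivative] by fastforce
    then have "((\<lambda>z. \<psi> (w + z *s v)) has_derivative (\<lambda>h. A (h *s v))) (at z)"
      using A(1) by (rule has_derivative_compose)
    then have "((\<lambda>z. \<psi> (w + z *s v) $ i) has_derivative (\<lambda>h. A (h *s v) $ i)) (at z)"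
      by (rule bounded_linear.has_derivative[OF bounded_linear_vec_nth])
    moreover have "(\<lambda>h. A (h *s v) $ i) = (*) (A v $ i)" by (auto simp: A(2) mult.commute)
    ultimately have "((\<lambda>z. \<psi> (w + z *s v) $ i) has_field_derivative (A v $ i)) (at z)"
      by (simp add: has_field_derivative_def)
    then show "(\<lambda>z. \<psi> (w + z *s v) $ i) field_differentiable at z within ball 0 1"
      using field_differentiable_at_within field_differentiable_def by blast
  qed
qed (use M in auto)

lemma holomorphic_disc_const: "x \<in> M \<Longrightarrow> holomorphic_disc M (\<lambda>z. x)"
  by (auto simp: holomorphic_disc_def)

lemma holomorphic_map_on_continuous:
  assumes "holomorphic_map_on \<phi> U" shows "continuous_on U \<phi>"
  using assms unfolding holomorphic_map_on_def
  by (meson continuous_at_imp_continuous_on has_derivative_continuous)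

text \<open>The left inverse \<psi> makes \<phi> injective on U, so the equality of images in the
  definition becomes a pointwise test for membership in M.\<close>

lemma submanifold_chart:
  fixes M :: "(complex ^ 'm) set"
  assumes "embedded_complex_submanifold M" "p \<in> M"
  obtains I U and \<phi> \<psi> :: "complex ^ 'm \<Rightarrow> complex ^ 'm" where "open U" "p \<in> U" "open (\<phi> ` U)" "continuous_on U \<phi>"
    "holomorphic_map_on \<psi> (\<phi> ` U)" "\<And>z. z \<in> U \<Longrightarrow> \<psi> (\<phi> z) = z"
    "\<And>z. z \<in> U \<Longrightarrow> z \<in> M \<longleftrightarrow> (\<forall>i. i \<notin> I \<longrightarrow> \<phi> z $ i = 0)"
proof -
  from assms obtain I U and \<phi> \<psi> :: "complex ^ 'm \<Rightarrow> complex ^ 'm" where 1: "open U" "p \<in> U" "open (\<phi> ` U)"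
    "holomorphic_map_on \<phi> U" "holomorphic_map_on \<psi> (\<phi> ` U)" "\<forall>z\<in>U. \<psi> (\<phi> z) = z"
    and eq: "\<phi> ` (U \<inter> M) = \<phi> ` U \<inter> {w. \<forall>i. i \<notin> I \<longrightarrow> w $ i = 0}"
    unfolding embedded_complex_submanifold_def by blast
  have "z \<in> M \<longleftrightarrow> (\<forall>i. i \<notin> I \<longrightarrow> \<phi> z $ i = 0)" if "z \<in> U" for z
  proof
    assume "z \<in> M"
    then have "\<phi> z \<in> \<phi> ` (U \<inter> M)" using that by blast
    then show "\<forall>i. i \<notin> I \<longrightarrow> \<phi> z $ i = 0" using eq by blast
  next
    assume "\<forall>i. i \<notin> I \<longrightarrow> \<phi> z $ i = 0"
    then have "\<phi> z \<in> \<phi> ` (U \<inter> M)" using eq that by blast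
    then obtain z' where "z' \<in> U \<inter> M" "\<phi> z = \<phi> z'" by blast
    then show "z \<in> M" using 1(6) that by (metis IntD1 IntD2)
  qed
  with that[OF 1(1,2,3) holomorphic_map_on_continuous[OF 1(4)] 1(5)] 1(6) show thesis by blast
qed

text \<open>M need not be closed, but inside a closed ball contained in a chart it is the preimage
  of a closed coordinate subspace.\<close>

lemma submanifold_locally_compact:
  fixes M :: "(complex ^ 'm) set"
  assumes "embedded_complex_submanifold M" "p \<in> M"
  obtains r where "r > 0" "compact (cball p r \<inter> M)"
proof -
  obtain I U and \<phi> :: "complex ^ 'm \<Rightarrow> complex ^ 'm" where U: "open U" "p \<in> U" "continuous_on U \<phi>"
    and M: "\<And>z. z \<in> U \<Longrightarrow> z \<in> M \<longleftrightarrow> (\<forall>i. i \<notin> I \<longrightarrow> \<phi> z $ i = 0)"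
    using submanifold_chart[OF assms] by metis
  obtain r where r: "r > 0" "cball p r \<subseteq> U" using U open_contains_cball by blast
  have "closed (cball p r \<inter> \<phi> -` {w. \<forall>i. i \<notin> I \<longrightarrow> w $ i = 0})"
  proof (rule continuous_closed_preimage[OF continuous_on_subset[OF U(3) r(2)] closed_cball])
    show "closed {w :: complex ^ 'm. \<forall>i. i \<notin> I \<longrightarrow> w $ i = 0}"
      by (intro closed_Collect_all closed_Collect_imp closed_Collect_eq open_Collect_const continuous_intros)
  qed
  moreover have "cball p r \<inter> M = cball p r \<inter> \<phi> -` {w. \<forall>i. i \<notin> I \<longrightarrow> w $ i = 0}"
    using M r(2) by auto
  ultimately have "compact (cball p r \<inter> M)"
    using bounded_Int[of "cball p r"] by (metis bounded_cball compact_eq_bounded_closed)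
  with r(1) that show thesis by blast
qed

text \<open>In the chart, the complex line from the image of p towards that of x stays in the
  coordinate subspace. Scaled so that the unit disc maps into a ball of radius r, it reaches x at
  parameter \<open>norm (\<phi> x - \<phi> p) / r\<close>, which is small near p.\<close>

lemma submanifold_short_disc:
  fixes M :: "(complex ^ 'm) set"
  assumes "embedded_complex_submanifold M" "p \<in> M" "\<epsilon> > 0"
  obtains W where "open W" "p \<in> W" "\<And>x. x \<in> W \<inter> M \<Longrightarrow> \<exists>L<\<epsilon>. disc_step M p x L"
proof -
  obtain I U and \<phi> \<psi> :: "complex ^ 'm \<Rightarrow> complex ^ 'm" where U: "open U" "p \<in> U" "open (\<phi> ` U)" "continuous_on U \<phi>"
    "holomorphic_map_on \<psi> (\<phi> ` U)" "\<And>z. z \<in> U \<Longrightarrow> \<psi> (\<phi> z) = z"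
    and M: "\<And>z. z \<in> U \<Longrightarrow> z \<in> M \<longleftrightarrow> (\<forall>i. i \<notin> I \<longrightarrow> \<phi> z $ i = 0)"
    using submanifold_chart[OF assms(1,2)] by metis
  obtain r where r: "r > 0" "ball (\<phi> p) r \<subseteq> \<phi> ` U"
    using U(2,3) open_contains_ball by blast
  have "((\<lambda>t. artanh t) \<longlongrightarrow> artanh (0::real)) (at 0)"
    by (rule tendsto_artanh[OF tendsto_ident_at]) auto
  then have "\<forall>\<^sub>F t in at 0. artanh (t::real) < \<epsilon>"
    using order_tendstoD(2) assms(3) by fastforce
  \<comment> \<open>The limit is over a punctured neighbourhood, hence \<open>t \<noteq> 0\<close>;
    the case x = p is handled by a constant disc.\<close>
  then obtain \<eta> where \<eta>: "\<eta> > 0" "\<And>t::real. \<lbrakk>t \<noteq> 0; \<bar>t\<bar> < \<eta>\<rbrakk> \<Longrightarrow> artanh t < \<epsilon>"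
    unfolding eventually_at by (auto simp: dist_real_def)
  \<comment> \<open>The factor \<open>min \<eta> 1\<close> makes the parameter t smaller than
    \<eta>, for a short disc, and smaller than 1, to lie in the unit disc.\<close>
  define W where "W = U \<inter> \<phi> -` ball (\<phi> p) (r * min \<eta> 1)"
  have "open W" unfolding W_def by (rule continuous_open_preimage[OF U(4,1) open_ball])
  moreover have "p \<in> W" using U(2) r(1) \<eta>(1) by (simp add: W_def)
  moreover have "\<exists>L<\<epsilon>. disc_step M p x L" if x: "x \<in> W \<inter> M" for x
  proof -
    have xU: "x \<in> U" "x \<in> M" "norm (\<phi> x - \<phi> p) < r * min \<eta> 1"
      using x by (auto simp: W_def dist_norm norm_minus_commute)
    define v where "v = \<phi> x - \<phi> p"
    show ?thesis
    proof (cases "v = 0")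
      case True
      then have "x = p" using U(6) xU U(2) by (metis eq_iff_diff_eq_0 v_def)
      then show ?thesis
        unfolding disc_step_def using assms(3) holomorphic_disc_const[OF assms(2)]
        by (intro exI[of _ 0] conjI exI[of _ "\<lambda>z. p"]) (auto simp: poincare_dist_def)
    next
      case False
      define t where "t = norm v / r"
      have t: "t > 0" "t < \<eta>" "t < 1"
      proof -
        have "norm v < r * min \<eta> 1" using xU(3) by (simp add: v_def)
        moreover have "r * min \<eta> 1 \<le> r * \<eta>" "r * min \<eta> 1 \<le> r * 1"
          using r(1) by (intro mult_left_mono; simp)+
        ultimately have "norm v < r * \<eta>" "norm v < r" by linarith+
        then show "t < \<eta>" "t < 1" using r(1) by (simp_all add: t_def field_simps)
      qed (use r(1) False in \<open>simp add: t_def\<close>)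
      define u where "u = complex_of_real (1 / t) *s v"
      have nu: "norm u = r" 
      proof -
        have "norm u = norm v / t" using t(1) by (simp add: u_def norm_vector_scalar_mult norm_divide)
        then show ?thesis using r(1) False by (simp add: t_def)
      qed
      have inU: "\<phi> p + z *s u \<in> \<phi> ` U" if "norm z < 1" for z
      proof -
        have "norm (z *s u) < r" using that r(1) by (simp add: norm_vector_scalar_mult nu)
        then have "\<phi> p + z *s u \<in> ball (\<phi> p) r" by (simp add: dist_norm)
        then show ?thesis using r(2) by blast
      qed
      have "\<phi> p $ i = 0" "\<phi> x $ i = 0" if "i \<notin> I" for i
        using M[OF U(2)] M[OF xU(1)] xU(2) assms(2) that by auto
      then have inM: "\<psi> (\<phi> p + z *s u) \<in> M" if "norm z < 1" for z
      proof -
        obtain y where y: "y \<in> U" "\<phi> p + z *s u = \<phi> y" using inU[OF \<open>norm z < 1\<close>] by blast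
        have "\<phi> y $ i = 0" if "i \<notin> I" for i
          using \<open>\<And>i. i \<notin> I \<Longrightarrow> \<phi> p $ i = 0\<close>[OF that] \<open>\<And>i. i \<notin> I \<Longrightarrow> \<phi> x $ i = 0\<close>[OF that]
          unfolding y(2)[symmetric] by (simp add: u_def v_def)
        then show ?thesis using M[OF y(1)] U(6)[OF y(1)] y(2) by simp
      qed
      have "complex_of_real t *s u = v" using t(1) by (simp add: u_def)
      then have "\<psi> (\<phi> p + complex_of_real t *s u) = x" using U(6)[OF xU(1)] by (simp add: v_def)
      moreover have "\<psi> (\<phi> p + 0 *s u) = p" using U(6)[OF U(2)] by simp
      moreover have "poincare_dist 0 (complex_of_real t) = artanh t"
        using t(1) by (simp add: poincare_dist_def)
      ultimately have "disc_step M p x (artanh t)"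
        unfolding disc_step_def using t holomorphic_disc_chart[OF U(5) inU inM]
        by (intro exI[of _ "\<lambda>z. \<psi> (\<phi> p + z *s u)"] exI[of _ 0] exI[of _ "complex_of_real t"]) auto
      moreover have "artanh t < \<epsilon>" using \<eta>(2) t by auto
      ultimately show ?thesis by blast
    qed
  qed
  ultimately show thesis using that by blast
qed

text \<open>Being joined by one disc is symmetric, and short discs make each point related to a
  neighbourhood of it in M. Connectedness leaves a single class, so the infimum defining the
  distance is over a nonempty set.\<close>

lemma kobayashi_chain_exists:
  fixes M :: "(complex ^ 'm) set"
  assumes "embedded_complex_submanifold M" "connected M" "p \<in> M" "q \<in> M"
  obtains L where "kobayashi_chain_length M p q L"
proof -
  define R where "R x y \<longleftrightarrow> (\<exists>L. disc_step M x y L)" for x y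
  have "R\<^sup>*\<^sup>* p q"
  proof (rule connected_equivalence_relation[OF assms(2-4)])
    have "symp R" unfolding R_def disc_step_def by (intro sympI) blast
    then show "R\<^sup>*\<^sup>* x y \<Longrightarrow> R\<^sup>*\<^sup>* y x" for x y using symp_rtranclp sympD by metis
    show "\<lbrakk>R\<^sup>*\<^sup>* x y; R\<^sup>*\<^sup>* y z\<rbrakk> \<Longrightarrow> R\<^sup>*\<^sup>* x z" for x y z by (rule rtranclp_trans)
    fix a assume a: "a \<in> M"
    obtain W where "open W" "a \<in> W" "\<And>x. x \<in> W \<inter> M \<Longrightarrow> \<exists>L<1. disc_step M a x L"
      using submanifold_short_disc[OF assms(1) a zero_less_one] by blast
    then show "\<exists>T. openin (top_of_set M) T \<and> a \<in> T \<and> (\<forall>x\<in>T. R\<^sup>*\<^sup>* a x)"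
      using a unfolding R_def by (intro exI[of _ "M \<inter> W"]) (blast intro: openin_open_Int)
  qed
  then have "\<exists>L. kobayashi_chain_length M p q L"
  proof (induction rule: rtranclp_induct)
    case base
    then show ?case using kobayashi_chain_length_refl by blast
  next
    case (step y z)
    then show ?case unfolding R_def using kobayashi_chain_length_append by blast
  qed
  with that show thesis by blast
qed

text \<open>The chain estimate passes to the infimum. It also makes chain lengths nonnegative, the
  lower bound that later upper estimates of the infimum require.\<close>

lemma kobayashi_dist_lower_bound:
  fixes M :: "(complex ^ 'm) set"
  assumes "embedded_complex_submanifold M" "connected M" "bounded M"
  obtains C where "C > 0" "\<And>x y. \<lbrakk>x \<in> M; y \<in> M\<rbrakk> \<Longrightarrow> norm (x - y) \<le> C * kobayashi_dist M x y"
    "\<And>x y L. kobayashi_chain_length M x y L \<Longrightarrow> 0 \<le> L"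
proof -
  obtain R where R: "R > 0" "\<And>x. x \<in> M \<Longrightarrow> norm x \<le> R"
    using assms(3) unfolding bounded_pos by blast
  define C where "C = real CARD('m) * (6 * R)"
  have C: "C > 0" unfolding C_def using R(1) by simp
  have chain: "norm (x - y) \<le> C * L" if "kobayashi_chain_length M x y L" for x y L
    unfolding C_def by (rule kobayashi_chain_length_bound[OF that R])
  have "norm (x - y) \<le> C * kobayashi_dist M x y" if "x \<in> M" "y \<in> M" for x y
  proof -
    have "norm (x - y) / C \<le> Inf {L. kobayashi_chain_length M x y L}"
    proof (rule cInf_greatest)
      show "{L. kobayashi_chain_length M x y L} \<noteq> {}"
        using kobayashi_chain_exists[OF assms(1,2) that] by blast
    qed (use chain C in \<open>auto simp: field_simps\<close>)
    then show ?thesis using that C by (simp add: kobayashi_dist_def field_simps)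
  qed
  moreover have "0 \<le> L" if "kobayashi_chain_length M x y L" for x y L
    using order_trans[OF norm_ge_zero chain[OF that]] C by (simp add: zero_le_mult_iff)
  ultimately show thesis using that C by blast
qed

text \<open>Near l a single short disc is already a chain. Together with the lower bound this shows
  that the Kobayashi and Euclidean topologies agree.\<close>

lemma kobayashi_dist_tendsto:
  fixes M :: "(complex ^ 'm) set"
  assumes M: "embedded_complex_submanifold M" "connected M" "bounded M"
    and x: "\<And>n. x n \<in> M" "l \<in> M" "(x \<longlongrightarrow> l) F"
  shows "((\<lambda>n. kobayashi_dist M l (x n)) \<longlongrightarrow> 0) F"
proof (rule tendstoI)
  fix \<epsilon> :: real assume \<epsilon>: "\<epsilon> > 0"
  obtain C where C: "C > 0" "\<And>x y. \<lbrakk>x \<in> M; y \<in> M\<rbrakk> \<Longrightarrow> norm (x - y) \<le> C * kobayashi_dist M x y"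
    "\<And>x y L. kobayashi_chain_length M x y L \<Longrightarrow> 0 \<le> L"
    using kobayashi_dist_lower_bound[OF M] by metis
  obtain W where W: "open W" "l \<in> W" "\<And>x. x \<in> W \<inter> M \<Longrightarrow> \<exists>L<\<epsilon>. disc_step M l x L"
    using submanifold_short_disc[OF M(1) x(2) \<epsilon>] by blast
  have "\<forall>\<^sub>F n in F. x n \<in> W" using topological_tendstoD[OF x(3) W(1,2)] .
  then show "\<forall>\<^sub>F n in F. dist (kobayashi_dist M l (x n)) 0 < \<epsilon>"
  proof eventually_elim
    case (elim n)
    then obtain L where L: "L < \<epsilon>" "disc_step M l (x n) L" using W(3) x(1) by blast
    have "kobayashi_chain_length M l (x n) (0 + L)"
      using kobayashi_chain_length_append[OF kobayashi_chain_length_refl L(2)] .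
    then have "Inf {L. kobayashi_chain_length M l (x n) L} \<le> L"
      using C(3) by (intro cInf_lower bdd_belowI[of _ 0]) auto
    then have "kobayashi_dist M l (x n) \<le> L" using x(1,2) by (simp add: kobayashi_dist_def)
    moreover have "0 \<le> kobayashi_dist M l (x n)"
      using order_trans[OF norm_ge_zero C(2)[OF x(2,1)]] C(1) by (simp add: zero_le_mult_iff)
    ultimately show ?case using L(1) by simp
  qed
qed

section \<open>Isometric embeddings for the Kobayashi distance\<close>

text \<open>A geodesic subspace offers a geodesic on an arbitrary interval, passing through two
  points in either order; here the piece between them is cut out and oriented.\<close>

lemma geodesic_on_reparam:
  assumes \<sigma>: "geodesic_on X d I \<sigma>" and st: "s \<in> I" "t \<in> I"
  obtains c where "geodesic_on X d {0..\<bar>s - t\<bar>} c" "c 0 = \<sigma> s" "c \<bar>s - t\<bar> = \<sigma> t"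
    "c ` {0..\<bar>s - t\<bar>} \<subseteq> \<sigma> ` I"
proof -
  \<comment> \<open>The sign e is the direction of travel from s to t.\<close>
  define e :: real where "e = (if s \<le> t then 1 else -1)"
  have e: "\<bar>s - t\<bar> = e * (t - s)" "e * e = 1" "\<bar>e\<bar> = 1" by (auto simp: e_def)
  have inI: "s + e * u \<in> I" if "u \<in> {0..\<bar>s - t\<bar>}" for u
  proof -
    have "is_interval I" using \<sigma> unfolding geodesic_on_def by blast
    moreover have "s + e * u \<in> {min s t..max s t}" using that by (auto simp: e_def split: if_splits)
    ultimately show ?thesis using st unfolding is_interval_1
      by (metis atLeastAtMost_iff max_def min_def)
  qed
  show thesis
  proof (rule that[of "\<lambda>u. \<sigma> (s + e * u)"])
    show "geodesic_on X d {0..\<bar>s - t\<bar>} (\<lambda>u. \<sigma> (s + e * u))"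
      unfolding geodesic_on_def
    proof (intro conjI ballI)
      fix u v assume "u \<in> {0..\<bar>s - t\<bar>}" "v \<in> {0..\<bar>s - t\<bar>}"
      then have "d (\<sigma> (s + e * u)) (\<sigma> (s + e * v)) = \<bar>(s + e * u) - (s + e * v)\<bar>"
        using \<sigma> inI unfolding geodesic_on_def by blast
      also have "\<dots> = \<bar>u - v\<bar>" using e(3) by (simp add: abs_mult flip: right_diff_distrib)
      finally show "d (\<sigma> (s + e * u)) (\<sigma> (s + e * v)) = \<bar>u - v\<bar>" .
    next
      show "(\<lambda>u. \<sigma> (s + e * u)) ` {0..\<bar>s - t\<bar>} \<subseteq> X"
        using \<sigma> inI unfolding geodesic_on_def by blast
    qed (simp add: is_interval_cc)
    show "\<sigma> (s + e * \<bar>s - t\<bar>) = \<sigma> t" using e(2) unfolding e(1) by (simp add: mult.assoc[symmetric])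
  qed (use inI in auto)
qed

locale kobayashi_isometry =
  fixes M :: "(complex ^ 'm) set" and N :: "(complex ^ 'n) set"
    and f :: "complex ^ 'm \<Rightarrow> complex ^ 'n"
  assumes M: "embedded_complex_submanifold M" "connected M" "bounded M"
    and N: "embedded_complex_submanifold N" "connected N" "bounded N"
    and complete: "complete_distance_space M (kobayashi_dist M)"
    and f_range: "f ` M \<subseteq> N"
    and f_isometry: "\<And>x y. \<lbrakk>x \<in> M; y \<in> M\<rbrakk> \<Longrightarrow> kobayashi_dist N (f x) (f y) = kobayashi_dist M x y"
    and geodesic: "geodesic_subspace N (f ` M)"
begin

sublocale Metric_space M "kobayashi_dist M"
  using complete unfolding complete_distance_space_def by blast

lemma kobayashi_mcomplete: mcomplete
  using complete unfolding complete_distance_space_def by blast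

lemma kobayashi_limit_iff:
  assumes "\<And>n. x n \<in> M" "l \<in> M"
  shows "((\<lambda>n. kobayashi_dist M (x n) l) \<longlongrightarrow> 0) F \<longleftrightarrow> (x \<longlongrightarrow> l) F"
proof
  obtain C where C: "C > 0" "\<And>x y. \<lbrakk>x \<in> M; y \<in> M\<rbrakk> \<Longrightarrow> norm (x - y) \<le> C * kobayashi_dist M x y"
    using kobayashi_dist_lower_bound[OF M] by metis
  assume "((\<lambda>n. kobayashi_dist M (x n) l) \<longlongrightarrow> 0) F"
  then have "((\<lambda>n. x n - l) \<longlongrightarrow> 0) F"
    by (rule tendsto_0_le[where K = C]) (use C assms in \<open>auto simp: mult.commute intro!: always_eventually\<close>)
  then show "(x \<longlongrightarrow> l) F" by (rule LIM_zero_cancel)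
qed (use kobayashi_dist_tendsto[OF M assms] in \<open>simp add: commute\<close>)

text \<open>Euclidean bicontinuity of f is extracted from the isometry, because on both M and N the
  Kobayashi distance induces the Euclidean topology.\<close>

lemma image_limit_iff:
  assumes "\<And>n. x n \<in> M" "l \<in> M"
  shows "((\<lambda>n. f (x n)) \<longlongrightarrow> f l) F \<longleftrightarrow> ((\<lambda>n. kobayashi_dist M (x n) l) \<longlongrightarrow> 0) F"
proof
  have fN: "f (x n) \<in> N" "f l \<in> N" for n using f_range assms by auto
  show "((\<lambda>n. kobayashi_dist M (x n) l) \<longlongrightarrow> 0) F" if "((\<lambda>n. f (x n)) \<longlongrightarrow> f l) F"
    using kobayashi_dist_tendsto[OF N fN that] unfolding f_isometry[OF assms(2,1)] commute[of l] .
  obtain C where C: "C > 0" "\<And>x y. \<lbrakk>x \<in> N; y \<in> N\<rbrakk> \<Longrightarrow> norm (x - y) \<le> C * kobayashi_dist N x y"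
    using kobayashi_dist_lower_bound[OF N] by metis
  assume "((\<lambda>n. kobayashi_dist M (x n) l) \<longlongrightarrow> 0) F"
  then have "((\<lambda>n. f (x n) - f l) \<longlongrightarrow> 0) F"
  proof (rule tendsto_0_le[where K = C])
    have "norm (f (x n) - f l) \<le> C * kobayashi_dist M (x n) l" for n
      using C(2)[OF fN] f_isometry assms by simp
    then show "\<forall>\<^sub>F n in F. norm (f (x n) - f l) \<le> norm (kobayashi_dist M (x n) l) * C"
      by (simp add: mult.commute)
  qed
  then show "((\<lambda>n. f (x n)) \<longlongrightarrow> f l) F" by (rule LIM_zero_cancel)
qed

lemma isometry_inj_on: "inj_on f M"
proof (rule inj_onI)
  fix x y assume "x \<in> M" "y \<in> M" "f x = f y"
  then have "kobayashi_dist M x y = kobayashi_dist M x x" using f_isometry by metis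
  then show "x = y" using \<open>x \<in> M\<close> \<open>y \<in> M\<close> by simp
qed

lemma geodesic_image:
  assumes "geodesic_on M (kobayashi_dist M) I c"
  shows "geodesic_on N (kobayashi_dist N) I (\<lambda>t. f (c t))"
    "geodesic_on (f ` M) (kobayashi_dist N) I (\<lambda>t. f (c t))"
  using assms f_isometry f_range unfolding geodesic_on_def by (auto simp: image_subset_iff)

text \<open>A geodesic of N inside the image pulls back through the inverse of f; the isometry
  forces its length to be the distance in M.\<close>

lemma segment_exists:
  assumes xy: "x \<in> M" "y \<in> M"
  shows "\<exists>c. geodesic_on M (kobayashi_dist M) {0..kobayashi_dist M x y} c \<and> c 0 = x \<and>
    c (kobayashi_dist M x y) = y"
proof (cases "x = y")
  case True
  then show ?thesis using xy is_interval_cc[of "0::real" 0]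
    by (intro exI[of _ "\<lambda>t. x"]) (auto simp: geodesic_on_def)
next
  case False
  then have "f x \<noteq> f y" using isometry_inj_on xy by (meson inj_onD)
  then obtain I \<sigma> where \<sigma>: "geodesic_on N (kobayashi_dist N) I \<sigma>" "f x \<in> \<sigma> ` I" "f y \<in> \<sigma> ` I"
    "\<sigma> ` I \<subseteq> f ` M"
    using geodesic xy unfolding geodesic_subspace_def by blast
  then obtain s t where st: "s \<in> I" "t \<in> I" "\<sigma> s = f x" "\<sigma> t = f y" by auto
  have dist: "kobayashi_dist M x y = \<bar>s - t\<bar>"
    using \<sigma>(1) st f_isometry[OF xy] unfolding geodesic_on_def by metis
  obtain c where c: "geodesic_on N (kobayashi_dist N) {0..\<bar>s - t\<bar>} c" "c 0 = f x" "c \<bar>s - t\<bar> = f y"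
    "c ` {0..\<bar>s - t\<bar>} \<subseteq> f ` M"
    using geodesic_on_reparam[OF \<sigma>(1) st(1,2)] st(3,4) \<sigma>(4) by (metis (no_types, lifting) order_trans)
  define b where "b u = inv_into M f (c u)" for u
  have b: "b u \<in> M" "f (b u) = c u" if "u \<in> {0..\<bar>s - t\<bar>}" for u
  proof -
    have "c u \<in> f ` M" using c(4) that by blast
    then show "b u \<in> M" "f (b u) = c u" unfolding b_def by (rule inv_into_into, rule f_inv_into_f)
  qed
  have "geodesic_on M (kobayashi_dist M) {0..\<bar>s - t\<bar>} b"
    unfolding geodesic_on_def
  proof (intro conjI ballI)
    fix u v assume uv: "u \<in> {0..\<bar>s - t\<bar>}" "v \<in> {0..\<bar>s - t\<bar>}"
    then have "kobayashi_dist M (b u) (b v) = kobayashi_dist N (c u) (c v)"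
      using f_isometry[of "b u" "b v"] b by simp
    then show "kobayashi_dist M (b u) (b v) = \<bar>u - v\<bar>"
      using c(1) uv unfolding geodesic_on_def by simp
  qed (use b in \<open>auto simp: is_interval_cc\<close>)
  moreover have "b 0 = x" "b \<bar>s - t\<bar> = y"
    using c(2,3) xy isometry_inj_on by (auto simp: b_def)
  ultimately show ?thesis unfolding dist by blast
qed

text \<open>The lower bound places a small Kobayashi ball inside a Euclidean compact piece of M.
  Subsequences converging there in norm also converge, hence are Cauchy, for the Kobayashi
  distance.\<close>

lemma locally_totally_bounded:
  assumes x: "x \<in> M"
  shows "\<exists>e>0. mtotally_bounded (mball x e)"
proof -
  obtain C where C: "C > 0" "\<And>x y. \<lbrakk>x \<in> M; y \<in> M\<rbrakk> \<Longrightarrow> norm (x - y) \<le> C * kobayashi_dist M x y"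
    using kobayashi_dist_lower_bound[OF M] by metis
  obtain r where r: "r > 0" "compact (cball x r \<inter> M)"
    using submanifold_locally_compact[OF M(1) x] by blast
  have sub: "mball x (r / C) \<subseteq> cball x r \<inter> M"
  proof
    fix y assume "y \<in> mball x (r / C)"
    then have "y \<in> M" "C * kobayashi_dist M x y \<le> r" using C(1) by (auto simp: field_simps)
    then show "y \<in> cball x r \<inter> M" using C(2)[OF x, of y] by (simp add: dist_norm)
  qed
  have "mtotally_bounded (mball x (r / C))"
    unfolding mtotally_bounded_sequentially
  proof (intro conjI allI impI)
    fix \<sigma> :: "nat \<Rightarrow> complex ^ 'm" assume "range \<sigma> \<subseteq> mball x (r / C)"
    then have \<sigma>: "\<And>n. \<sigma> n \<in> cball x r \<inter> M" using sub by blast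
    then obtain l q where l: "l \<in> M" "strict_mono q" "(\<sigma> \<circ> q) \<longlonglongrightarrow> l"
      using r(2) unfolding compact_def by (metis IntD2)
    then have "(\<lambda>n. kobayashi_dist M ((\<sigma> \<circ> q) n) l) \<longlonglongrightarrow> 0"
      using kobayashi_limit_iff[of "\<sigma> \<circ> q" l] \<sigma> by simp
    then have "limitin mtopology (\<sigma> \<circ> q) l sequentially"
      using l(1) \<sigma> by (simp add: limitin_metric_dist_null)
    then have "MCauchy (\<sigma> \<circ> q)"
      by (rule convergent_imp_MCauchy[rotated]) (use \<sigma> in auto)
    with l(2) show "\<exists>q. strict_mono q \<and> MCauchy (\<sigma> \<circ> q)" by blast
  qed auto
  with r(1) C(1) show ?thesis by (intro exI[of _ "r / C"]) simp
qed

lemma kobayashi_proper: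
  assumes p: "p \<in> M"
  shows "proper_geodesic_space M (kobayashi_dist M) p"
proof
  fix x :: "nat \<Rightarrow> complex ^ 'm" and B
  assume x: "\<And>n. x n \<in> M" "\<And>n. kobayashi_dist M p (x n) \<le> B"
  have "mtotally_bounded (mcball p B)"
  proof (rule hopf_rinow_totally_bounded[OF kobayashi_mcomplete p locally_totally_bounded])
    fix x y s assume xy: "x \<in> M" "y \<in> M" "0 \<le> s" "s \<le> kobayashi_dist M x y"
    obtain c where c: "geodesic_on M (kobayashi_dist M) {0..kobayashi_dist M x y} c" "c 0 = x"
      "c (kobayashi_dist M x y) = y"
      using segment_exists[OF xy(1,2)] by blast
    have "c s \<in> M" "kobayashi_dist M (c 0) (c s) = s"
      "kobayashi_dist M (c s) (c (kobayashi_dist M x y)) = kobayashi_dist M x y - s"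
      using c(1) xy(3,4) unfolding geodesic_on_def by auto
    with c(2,3) show "\<exists>z\<in>M. kobayashi_dist M x z = s \<and> kobayashi_dist M z y = kobayashi_dist M x y - s"
      by metis
  qed
  moreover have "range x \<subseteq> mcball p B" using x p by auto
  ultimately obtain r where r: "strict_mono r" "MCauchy (x \<circ> r)"
    unfolding mtotally_bounded_sequentially by blast
  then obtain l where "limitin mtopology (x \<circ> r) l sequentially"
    using kobayashi_mcomplete unfolding mcomplete_def by blast
  then show "\<exists>l\<in>M. \<exists>r. strict_mono r \<and> (\<lambda>n. kobayashi_dist M (x (r n)) l) \<longlonglongrightarrow> 0"
    using r(1) by (auto simp: limitin_metric_dist_null)
qed (use p segment_exists in auto)

text \<open>This converts the compact set of the visibility condition into a ball about p: preimages
  escaping to infinity would have images subconverging to some \<open>f l\<close>, and so would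
  themselves subconverge to l.\<close>

lemma bounded_preimage:
  assumes p: "p \<in> M" and K: "compact K" "K \<subseteq> f ` M"
  obtains B where "\<And>x. \<lbrakk>x \<in> M; f x \<in> K\<rbrakk> \<Longrightarrow> kobayashi_dist M p x \<le> B"
proof -
  have "\<exists>B. \<forall>x\<in>M. f x \<in> K \<longrightarrow> kobayashi_dist M p x \<le> B"
  proof (rule ccontr)
    assume "\<not> ?thesis"
    then have "\<forall>n::nat. \<exists>x\<in>M. f x \<in> K \<and> real n < kobayashi_dist M p x" by (metis not_le)
    then obtain x where x: "\<And>n. x n \<in> M" "\<And>n. f (x n) \<in> K" "\<And>n::nat. real n < kobayashi_dist M p (x n)"
      by metis
    have "\<forall>n. f (x n) \<in> K" using x(2) by blast
    then obtain k q where kq: "k \<in> K" "strict_mono q" "((\<lambda>n. f (x n)) \<circ> q) \<longlonglongrightarrow> k"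
      using K(1)[unfolded compact_def, rule_format, of "\<lambda>n. f (x n)"] by blast
    then obtain l where l: "l \<in> M" "k = f l" using K(2) by blast
    interpret proper_geodesic_space M "kobayashi_dist M" p by (rule kobayashi_proper[OF p])
    have "(\<lambda>n. kobayashi_dist M p (x (q n))) \<longlonglongrightarrow> kobayashi_dist M p l"
    proof (rule base_dist_tendsto)
      show "(\<lambda>n. kobayashi_dist M (x (q n)) l) \<longlonglongrightarrow> 0"
        using kq(3) image_limit_iff[of "\<lambda>n. x (q n)" l] x(1) l by (simp add: o_def)
    qed (use x(1) l(1) in auto)
    moreover have "filterlim (\<lambda>n. kobayashi_dist M p (x (q n))) at_top sequentially"
    proof (rule filterlim_at_top_mono[OF filterlim_real_sequentially])
      have "real n \<le> kobayashi_dist M p (x (q n))" for n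
        using x(3)[of "q n"] seq_suble[OF kq(2), of n] by linarith
      then show "\<forall>\<^sub>F n in sequentially. real n \<le> kobayashi_dist M p (x (q n))" by simp
    qed
    ultimately show False
      using not_tendsto_and_filterlim_at_infinity[OF sequentially_bot] filterlim_at_top_imp_at_infinity
      by blast
  qed
  with that show thesis by blast
qed

lemma isometry_visible_embedding:
  assumes p: "p \<in> M" and "gromov_hyperbolic M (kobayashi_dist M)" and vis: "visibility_subspace N (f ` M)"
  shows "visible_embedding M (kobayashi_dist M) p f"
proof -
  interpret proper_geodesic_space M "kobayashi_dist M" p by (rule kobayashi_proper[OF p])
  show ?thesis
  proof
    show "gromov_hyperbolic M (kobayashi_dist M)" by fact
    show "bounded (f ` M)" using N(3) f_range by (rule bounded_subset)
    fix P Q assume "P \<in> closure (f ` M) - f ` M" "Q \<in> closure (f ` M) - f ` M" "P \<noteq> Q"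
    then obtain U V K where UV: "open U" "P \<in> U" "open V" "Q \<in> V" and K: "compact K" "K \<subseteq> f ` M"
      and meet: "\<And>a b \<gamma>. \<lbrakk>a \<le> b; geodesic_on N (kobayashi_dist N) {a..b} \<gamma>; \<gamma> ` {a..b} \<subseteq> f ` M;
                    \<gamma> a \<in> U; \<gamma> b \<in> V\<rbrakk> \<Longrightarrow> \<gamma> ` {a..b} \<inter> K \<noteq> {}"
      using vis unfolding visibility_subspace_def ambient_boundary_def by metis
    obtain B where B: "\<And>x. \<lbrakk>x \<in> M; f x \<in> K\<rbrakk> \<Longrightarrow> kobayashi_dist M p x \<le> B"
      using bounded_preimage[OF p K] by blast
    have "\<exists>t\<in>{a..b}. kobayashi_dist M p (c t) \<le> B"
      if "a \<le> b" "geodesic_on M (kobayashi_dist M) {a..b} c" "f (c a) \<in> U" "f (c b) \<in> V" for a b c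
    proof -
      have cM: "c t \<in> M" if "t \<in> {a..b}" for t
        using \<open>geodesic_on M _ {a..b} c\<close> that unfolding geodesic_on_def by blast
      then have "(\<lambda>t. f (c t)) ` {a..b} \<inter> K \<noteq> {}"
        by (intro meet[OF that(1) geodesic_image(1)[OF that(2)] _ that(3,4)]) (use cM in blast)
      then obtain t where "t \<in> {a..b}" "f (c t) \<in> K" by blast
      with B cM show ?thesis by blast
    qed
    then have "\<forall>a b c. a \<le> b \<and> geodesic_on M (kobayashi_dist M) {a..b} c \<and> f (c a) \<in> U \<and> f (c b) \<in> V \<longrightarrow>
           (\<exists>t\<in>{a..b}. kobayashi_dist M p (c t) \<le> B)"
      by simp
    with UV show "\<exists>U V B. open U \<and> P \<in> U \<and> open V \<and> Q \<in> V \<and>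
        (\<forall>a b c. a \<le> b \<and> geodesic_on M (kobayashi_dist M) {a..b} c \<and> f (c a) \<in> U \<and> f (c b) \<in> V \<longrightarrow>
           (\<exists>t\<in>{a..b}. kobayashi_dist M p (c t) \<le> B))"
      by (intro exI conjI)
  qed (use image_limit_iff in blast)+
qed

end

text \<open>The sequence t witnesses that F is reached by sequences, so that P really occurs as a
  limit point; convergence excludes any other.\<close>

lemma limit_points_along_tendsto:
  assumes lim: "(\<gamma> \<longlongrightarrow> P) F" and "P \<in> A" and "filterlim t F sequentially"
  shows "limit_points_along \<gamma> F A = {P}"
proof (intro equalityI subsetI)
  fix x assume "x \<in> limit_points_along \<gamma> F A"
  then obtain u where u: "filterlim u F sequentially" "(\<lambda>k. \<gamma> (u k)) \<longlonglongrightarrow> x"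
    unfolding limit_points_along_def by blast
  then show "x \<in> {P}" using LIMSEQ_unique filterlim_compose[OF lim u(1)] by blast
next
  fix x assume "x \<in> {P}"
  then show "x \<in> limit_points_along \<gamma> F A"
    using assms filterlim_compose[OF lim assms(3)] unfolding limit_points_along_def by blast
qed

theorem theorem1p10:
  fixes M :: "(complex ^ 'm) set" and N :: "(complex ^ 'n) set"
    and f :: "complex ^ 'm \<Rightarrow> complex ^ 'n" and p :: "complex ^ 'm"
  assumes "embedded_complex_submanifold M" "connected M" "bounded M"
    and "embedded_complex_submanifold N" "connected N" "bounded N"
    and "complete_distance_space M (kobayashi_dist M)"
    and "gromov_hyperbolic M (kobayashi_dist M)"
    and "f ` M \<subseteq> N"
    and "\<forall>x\<in>M. \<forall>y\<in>M. kobayashi_dist N (f x) (f y) = kobayashi_dist M x y"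
    and "visibility_subspace N (f ` M)"
    and "p \<in> M"
  shows "\<exists>fh. continuous_map (gromov_compactification M (kobayashi_dist M) p)
                (top_of_set (closure N)) fh \<and>
              (\<forall>x\<in>M. fh (Inl x) = f x) \<and>
              ((\<nexists>\<gamma>. geodesic_loop N (f ` M) \<gamma>) \<longrightarrow>
                 homeomorphic_map (gromov_compactification M (kobayashi_dist M) p)
                   (top_of_set (closure (f ` M))) fh)"
proof -
  interpret kobayashi_isometry M N f
    using assms unfolding visibility_subspace_def by unfold_locales auto
  interpret visible_embedding M "kobayashi_dist M" p f
    using assms by (intro isometry_visible_embedding)
  show ?thesis
  proof (intro exI[of _ extension] conjI impI ballI)
    show "continuous_map (gromov_compactification M (kobayashi_dist M) p) (top_of_set (closure N)) extension"
      by (intro continuous_extension closure_mono f_range)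
    show "extension (Inl x) = f x" for x by simp
    assume noloop: "\<nexists>\<gamma>. geodesic_loop N (f ` M) \<gamma>"
    show "homeomorphic_map (gromov_compactification M (kobayashi_dist M) p)
            (top_of_set (closure (f ` M))) extension"
    proof (rule homeomorphic_extension, rule notI)
      fix \<gamma> P assume \<gamma>: "geodesic_on M (kobayashi_dist M) UNIV \<gamma>"
        and P: "((\<lambda>t. f (\<gamma> t)) \<longlongrightarrow> P) at_top" "((\<lambda>t. f (\<gamma> t)) \<longlongrightarrow> P) at_bot"
      have "\<gamma> \<in> geodesic_rays M (kobayashi_dist M)"
        using geodesic_onD[OF \<gamma>] by (intro rayI) auto
      then have "P \<in> closure (f ` M)" using ray_limit_ideal P(1) by blast
      moreover have "filterlim (\<lambda>n. - real n) at_bot sequentially"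
        using filterlim_real_sequentially by (simp add: filterlim_uminus_at_top)
      \<comment> \<open>Both ends of the image line have \<open>{P}\<close> as their set of limit
        points, so the two sets agree.\<close>
      ultimately have "geodesic_loop N (f ` M) (\<lambda>t. f (\<gamma> t))"
        using geodesic_image(2)[OF \<gamma>] P
        by (simp add: geodesic_loop_def limit_points_along_tendsto[OF _ _ filterlim_real_sequentially]
            limit_points_along_tendsto[of _ _ at_bot])
      with noloop show False by blast
    qed
  qed
qed

end
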